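(* Let $\eta,\kappa\in\{0,1,2,\dots\}\cup\{\infty\}$ with $\eta\ge2$, and let $S_{\boldsymbol\lambda}$ be a weighted shift on the directed tree $\mathscr T_{\eta,\kappa}$ with nonzero weights $\boldsymbol\lambda=\{\lambda_v\}_{v\in V_{\eta,\kappa}^\circ}\subseteq\mathbb C$ such that $e_0\in\mathcal D^\infty(S_{\boldsymbol\lambda})$. Suppose that there exists a sequence $\{\mu_i\}_{i=1}^\eta$ of Borel probability measures on $\mathbb R_+$ such that $$\int_0^\infty s^n\,d\mu_i(s)=\Big|\prod_{j=2}^{n+1}\lambda_{i,j}\Big|^2,\quad n\in\mathbb N,\ i\in J_\eta .$$ Then $S_{\boldsymbol\lambda}$ is subnormal provided that one of the following four conditions holds: (i) $\kappa=0$ and $\sum_{i=1}^\eta|\lambda_{i,1}|^2\int_0^\infty\frac1s\,d\mu_i(s)\le1$; (ii) $0<\kappa<\infty$ and $$\sum_{i=1}^\eta|\lambda_{i,1}|^2\int_0^\infty\frac1s\,d\mu_i(s)=1,$$ $$\Big|\prod_{j=0}^{l-1}\lambda_{-j}\Big|^2\sum_{i=1}^\eta|\lambda_{i,1}|^2\int_0^\infty\frac1{s^{l+1}}\,d\mu_i(s)=1,\quad l\in J_{\kappa-1},$$ $$\Big|\prod_{j=0}^{\kappa-1}\lambda_{-j}\Big|^2\sum_{i=1}^\eta|\lambda_{i,1}|^2\int_0^\infty\frac1{s^{\kappa+1}}\,d\mu_i(s)\le1;$$ (iii) $0<\kappa<\infty$ and there exists a Borel probability measure $\nu$ on $\mathbb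 R_+$ such that $$\int_0^\infty s^n\,d\nu(s)=\Big|\prod_{j=\kappa-n}^{\kappa-1}\lambda_{-j}\Big|^2,\quad n\in J_\kappa,$$ $$\int_\sigma s^\kappa\,d\nu(s)=\Big|\prod_{j=0}^{\kappa-1}\lambda_{-j}\Big|^2\sum_{i=1}^\eta|\lambda_{i,1}|^2\int_\sigma\frac1s\,d\mu_i(s)\quad\text{for every Borel set }\sigma\subseteq\mathbb R_+;$$ (iv) $\kappa=\infty$ and $$\sum_{i=1}^\eta|\lambda_{i,1}|^2\int_0^\infty\frac1s\,d\mu_i(s)=1,\qquad \Big|\prod_{j=0}^{l-1}\lambda_{-j}\Big|^2\sum_{i=1}^\eta|\lambda_{i,1}|^2\int_0^\infty\frac1{s^{l+1}}\,d\mu_i(s)=1\ \text{ for all } l\in\mathbb N .$$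
   Context: $\mathbb N=\{1,2,\dots\}$, $\mathbb R_+=[0,\infty)$. For $\iota\in\{0,1,2,\dots\}\cup\{\infty\}$, $J_\iota=\{k\in\mathbb N:k\le\iota\}$; sequences and sums indexed by $i=1,\dots,\eta$ are over $i\in J_\eta$. The directed tree $\mathscr T_{\eta,\kappa}=(V_{\eta,\kappa},E_{\eta,\kappa})$ has vertex set $V_{\eta,\kappa}=\{-k:k\in J_\kappa\}\sqcup\{0\}\sqcup\{(i,j):i\in J_\eta,\ j\in\mathbb N\}$ and edge set $E_{\eta,\kappa}=\{(-k,-k+1):k\in J_\kappa\}\sqcup\{(0,(i,1)):i\in J_\eta\}\sqcup\{((i,j),(i,j+1)):i\in J_\eta,\ j\in\mathbb N\}$, where an edge $(u,v)$ goes from the parent $u=\mathrm{par}(v)$ to the child $v$. If $\kappa<\infty$ the tree has root $-\kappa$; if $\kappa=\infty$ it is rootless. $V_{\eta,\kappa}^\circ$ is the set of non-root vertices. One writes $\lambda_{i,j}$ for $\lambda_{(i,j)}$. With $V=V_{\eta,\kappa}$, $\ell^2(V)$ is the Hilbert space of square summable complex functions on $V$, and $e_u$ is the characteristic function of $\{u\}$. The weighted shift $S_{\boldsymbol\lambda}$ with weights $\{\lambda_v\}_{v\in V^\circ}$ is the operator in $\ell^2(V)$ with domain $\{f\in\ell^2(V):\Lambda f\in\ell^2(V)\}$ and $S_{\boldsymbol\lambda}f=\Lambda f$, where $(\Lambda f)(v)=\lambda_vf(\mathrm{par}(v))$ for $v\in V^\circ$ and $(\Lambda f)(v)=0$ if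 $v$ is the root. For an operator $A$, $\mathcal D^\infty(A)=\bigcap_{n\ge0}\mathcal D(A^n)$. A densely defined operator $S$ in a complex Hilbert space $\mathcal H$ is subnormal if there are a complex Hilbert space $\mathcal K\supseteq\mathcal H$ (isometric embedding) and a normal (possibly unbounded) operator $N$ in $\mathcal K$ such that $Sh=Nh$ for all $h\in\mathcal D(S)$. Conventions: $\frac10=\infty$, so finiteness of $\int_0^\infty\frac1s\,d\mu(s)$ forces $\mu(\{0\})=0$; $0\cdot\infty=0$; $\int_0^\infty$ is integration over $\mathbb R_+$. *)

theory Defs
  imports "HOL-Analysis.Analysis" "HOL-Algebra.Module" "HOL-Library.Extended_Nat"
begin

definition complex_field :: "complex ring" where
  "complex_field = \<lparr>carrier = UNIV, mult = (*), one = 1, zero = 0, add = (+)\<rparr>"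

text \<open>The fields \<^const>\<open>mult\<close> and \<^const>\<open>one\<close>, inherited from the library's record
  type for modules, play no role for vector spaces.\<close>

record 'a inner_space = "(complex, 'a) module" +
  inner_prod :: "'a \<Rightarrow> 'a \<Rightarrow> complex"

definition hnorm :: "('a, 'm) inner_space_scheme \<Rightarrow> 'a \<Rightarrow> real" where
  "hnorm H x = sqrt (Re (inner_prod H x x))"

definition hdist :: "('a, 'm) inner_space_scheme \<Rightarrow> 'a \<Rightarrow> 'a \<Rightarrow> real" where
  "hdist H x y = hnorm H (x \<ominus>\<^bsub>H\<^esub> y)"

text \<open>The inner product is linear in its first argument. Positivity is stated for the real
  part only, because conjugate symmetry makes \<open>inner_prod H x x\<close> real.\<close>

definition inner_product_space :: "('a, 'm) inner_space_scheme \<Rightarrow> bool" where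
  "inner_product_space H \<longleftrightarrow>
     Module.module complex_field H \<and>
     (\<forall>x\<in>carrier H. \<forall>y\<in>carrier H. \<forall>z\<in>carrier H.
        inner_prod H (x \<oplus>\<^bsub>H\<^esub> y) z = inner_prod H x z + inner_prod H y z) \<and>
     (\<forall>c. \<forall>x\<in>carrier H. \<forall>y\<in>carrier H.
        inner_prod H (c \<odot>\<^bsub>H\<^esub> x) y = c * inner_prod H x y) \<and>
     (\<forall>x\<in>carrier H. \<forall>y\<in>carrier H. inner_prod H y x = cnj (inner_prod H x y)) \<and>
     (\<forall>x\<in>carrier H. x \<noteq> \<zero>\<^bsub>H\<^esub> \<longrightarrow> 0 < Re (inner_prod H x x))"

definition hilbert_space :: "('a, 'm) inner_space_scheme \<Rightarrow> bool" where
  "hilbert_space H \<longleftrightarrow>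
     inner_product_space H \<and>
     (\<forall>s. (\<forall>n. s n \<in> carrier H) \<and>
          (\<forall>\<epsilon>>0. \<exists>N. \<forall>m\<ge>N. \<forall>n\<ge>N. hdist H (s m) (s n) < \<epsilon>) \<longrightarrow>
          (\<exists>x\<in>carrier H. (\<lambda>n. hdist H (s n) x) \<longlonglongrightarrow> 0))"

definition linear_isometry ::
  "('a, 'm) inner_space_scheme \<Rightarrow> ('b, 'n) inner_space_scheme \<Rightarrow> ('a \<Rightarrow> 'b) \<Rightarrow> bool" where
  "linear_isometry H K U \<longleftrightarrow>
     U \<in> carrier H \<rightarrow> carrier K \<and>
     (\<forall>x\<in>carrier H. \<forall>y\<in>carrier H. U (x \<oplus>\<^bsub>H\<^esub> y) = U x \<oplus>\<^bsub>K\<^esub> U y) \<and>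
     (\<forall>c. \<forall>x\<in>carrier H. U (c \<odot>\<^bsub>H\<^esub> x) = c \<odot>\<^bsub>K\<^esub> U x) \<and>
     (\<forall>x\<in>carrier H. \<forall>y\<in>carrier H. inner_prod K (U x) (U y) = inner_prod H x y)"

text \<open>An operator is identified with its graph: \<open>(x, y) \<in> A\<close> means that \<open>x\<close> belongs to the
  domain of \<open>A\<close> and \<open>A x = y\<close>. The domain is \<open>Domain A\<close>, the operator product \<open>B A\<close> with its
  maximal domain is the relational composition \<open>A O B\<close> (first \<open>A\<close>, then \<open>B\<close>), and equality of
  graphs includes equality of domains.\<close>

definition linear_operator :: "('a, 'm) inner_space_scheme \<Rightarrow> ('a \<times> 'a) set \<Rightarrow> bool" where
  "linear_operator H A \<longleftrightarrow>
     A \<subseteq> carrier H \<times> carrier H \<and>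
     single_valued A \<and>
     (\<zero>\<^bsub>H\<^esub>, \<zero>\<^bsub>H\<^esub>) \<in> A \<and>
     (\<forall>(x, y)\<in>A. \<forall>(x', y')\<in>A. (x \<oplus>\<^bsub>H\<^esub> x', y \<oplus>\<^bsub>H\<^esub> y') \<in> A) \<and>
     (\<forall>c. \<forall>(x, y)\<in>A. (c \<odot>\<^bsub>H\<^esub> x, c \<odot>\<^bsub>H\<^esub> y) \<in> A)"

definition densely_defined :: "('a, 'm) inner_space_scheme \<Rightarrow> ('a \<times> 'a) set \<Rightarrow> bool" where
  "densely_defined H A \<longleftrightarrow>
     (\<forall>x\<in>carrier H. \<forall>\<epsilon>>0. \<exists>y\<in>Domain A. hdist H y x < \<epsilon>)"

definition closed_operator :: "('a, 'm) inner_space_scheme \<Rightarrow> ('a \<times> 'a) set \<Rightarrow> bool" where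
  "closed_operator H A \<longleftrightarrow>
     (\<forall>s t. \<forall>x\<in>carrier H. \<forall>y\<in>carrier H.
        (\<forall>n. (s n, t n) \<in> A) \<and>
        (\<lambda>n. hdist H (s n) x) \<longlonglongrightarrow> 0 \<and> (\<lambda>n. hdist H (t n) y) \<longlonglongrightarrow> 0 \<longrightarrow>
        (x, y) \<in> A)"

definition adjoint :: "('a, 'm) inner_space_scheme \<Rightarrow> ('a \<times> 'a) set \<Rightarrow> ('a \<times> 'a) set" where
  "adjoint H A =
     {(y, z). y \<in> carrier H \<and> z \<in> carrier H \<and>
              (\<forall>(x, w)\<in>A. inner_prod H w y = inner_prod H x z)}"

definition normal_operator :: "('a, 'm) inner_space_scheme \<Rightarrow> ('a \<times> 'a) set \<Rightarrow> bool" where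
  "normal_operator H N \<longleftrightarrow>
     linear_operator H N \<and> densely_defined H N \<and> closed_operator H N \<and>
     N O adjoint H N = adjoint H N O N"

text \<open>The domain of \<open>A ^^ 0\<close> is the whole type, hence the explicit restriction to the space.\<close>

definition C_infinity_domain :: "('a, 'm) inner_space_scheme \<Rightarrow> ('a \<times> 'a) set \<Rightarrow> 'a set" where
  "C_infinity_domain H A = carrier H \<inter> (\<Inter>n. Domain (A ^^ n))"

text \<open>The larger space \<open>K\<close> ranges over all Hilbert spaces whose vectors are taken from the same
  type as those of \<open>H\<close>; this is no restriction. If \<open>N\<close> is a normal extension of \<open>S\<close> in an
  arbitrary Hilbert space and \<open>E\<close> is its spectral measure, then the closed linear span of the
  vectors \<open>E \<sigma> h\<close> with \<open>h\<close> in \<open>H\<close> reduces \<open>N\<close> to a normal extension of \<open>S\<close>. The orthogonal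
  dimension of that span is at most the maximum of \<open>\<aleph>\<^sub>0\<close> and the dimension of \<open>H\<close>
  (and the span is trivial if \<open>H\<close> is), so it has no more elements than \<open>H\<close>.\<close>

definition subnormal :: "'a inner_space \<Rightarrow> ('a \<times> 'a) set \<Rightarrow> bool" where
  "subnormal H S \<longleftrightarrow>
     linear_operator H S \<and> densely_defined H S \<and>
     (\<exists>(K :: 'a inner_space) U N.
        hilbert_space K \<and> linear_isometry H K U \<and> normal_operator K N \<and>
        (\<forall>(h, g)\<in>S. (U h, U g) \<in> N))"

definition ell2 :: "'v set \<Rightarrow> ('v \<Rightarrow> complex) inner_space" where
  "ell2 V =
     \<lparr>carrier = {f. (\<forall>v. v \<notin> V \<longrightarrow> f v = 0) \<and> (\<lambda>v. (cmod (f v))\<^sup>2) summable_on V},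
      mult = undefined,
      one = undefined,
      zero = (\<lambda>v. 0),
      add = (\<lambda>f g v. f v + g v),
      smult = (\<lambda>c f v. c * f v),
      inner_prod = (\<lambda>f g. \<Sum>\<^sub>\<infinity>v\<in>V. f v * cnj (g v))\<rparr>"

text \<open>A directed tree is given by its vertices \<open>V\<close> and its edges \<open>E\<close>, where \<open>(u, v) \<in> E\<close> says
  that \<open>u\<close> is the parent of \<open>v\<close>. The root, if any, is the vertex without a parent.\<close>

definition nonroot :: "'v set \<Rightarrow> ('v \<times> 'v) set \<Rightarrow> 'v set" where
  "nonroot V E = {v\<in>V. \<exists>u. (u, v) \<in> E}"

definition par :: "('v \<times> 'v) set \<Rightarrow> 'v \<Rightarrow> 'v" where
  "par E v = (THE u. (u, v) \<in> E)"

definition shift_map ::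
  "'v set \<Rightarrow> ('v \<times> 'v) set \<Rightarrow> ('v \<Rightarrow> complex) \<Rightarrow> ('v \<Rightarrow> complex) \<Rightarrow> 'v \<Rightarrow> complex" where
  "shift_map V E lam f v = (if v \<in> nonroot V E then lam v * f (par E v) else 0)"

definition weighted_shift ::
  "'v set \<Rightarrow> ('v \<times> 'v) set \<Rightarrow> ('v \<Rightarrow> complex) \<Rightarrow> (('v \<Rightarrow> complex) \<times> ('v \<Rightarrow> complex)) set" where
  "weighted_shift V E lam =
     {(f, shift_map V E lam f) | f.
        f \<in> carrier (ell2 V) \<and> shift_map V E lam f \<in> carrier (ell2 V)}"

text \<open>\<open>Trunk k\<close> is the vertex \<open>-k\<close>, in particular \<open>Trunk 0\<close> is \<open>0\<close>, and \<open>Branch i j\<close> is \<open>(i, j)\<close>.\<close>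

datatype vertex = Trunk nat | Branch nat nat

definition J :: "enat \<Rightarrow> nat set" where
  "J \<iota> = {k. 1 \<le> k \<and> enat k \<le> \<iota>}"

definition tree_V :: "enat \<Rightarrow> enat \<Rightarrow> vertex set" where
  "tree_V \<eta> \<kappa> = {Trunk k | k. k \<in> J \<kappa>} \<union> {Trunk 0} \<union> {Branch i j | i j. i \<in> J \<eta> \<and> 1 \<le> j}"

definition tree_E :: "enat \<Rightarrow> enat \<Rightarrow> (vertex \<times> vertex) set" where
  "tree_E \<eta> \<kappa> =
     {(Trunk k, Trunk (k - 1)) | k. k \<in> J \<kappa>} \<union>
     {(Trunk 0, Branch i 1) | i. i \<in> J \<eta>} \<union>
     {(Branch i j, Branch i (j + 1)) | i j. i \<in> J \<eta> \<and> 1 \<le> j}"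

abbreviation tree_shift ::
  "enat \<Rightarrow> enat \<Rightarrow> (vertex \<Rightarrow> complex) \<Rightarrow> ((vertex \<Rightarrow> complex) \<times> (vertex \<Rightarrow> complex)) set" where
  "tree_shift \<eta> \<kappa> lam \<equiv> weighted_shift (tree_V \<eta> \<kappa>) (tree_E \<eta> \<kappa>) lam"

definition borel_prob_halfline :: "real measure \<Rightarrow> bool" where
  "borel_prob_halfline M \<longleftrightarrow>
     sets M = sets (restrict_space borel {0..}) \<and> emeasure M (space M) = 1"

end

theory Submission
  imports Defs
begin

text \<open>The shift has an explicit normal extension, which can be read off from the measures \<open>\<mu> i\<close>.
Give the vertex \<open>(i, j)\<close> the level \<open>j\<close> and the vertex \<open>-k\<close> the level \<open>-k\<close>; the shift raises
levels by one. On \<open>L\<^sup>2\<close> of a disjoint union of half-lines, one carrying \<open>\<mu> i\<close> for each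
branch \<open>i\<close> and integer level \<open>n\<close>, let \<open>N F (n, i, s) = sqrt s * F (n - 1, i, s)\<close>. This is a translation that
preserves the measure, followed by multiplication by a function that is invariant under it;
such an operator is normal, because its adjoint is the same multiplication combined with the
inverse translation (\<open>adjoint_translation\<close>, \<open>normal_translation\<close>).

The equation \<open>N U = U S\<close> dictates the isometry \<open>U\<close>. Let \<open>U e\<close> for \<open>e\<close> the basis vector at
\<open>(i, j)\<close> be the function \<open>s\<^bsup>(j - 1)/2\<^esup> / (\<lambda>\<^sub>i\<^sub>,\<^sub>2 \<dots> \<lambda>\<^sub>i\<^sub>,\<^sub>j)\<close> on level \<open>j\<close> of branch \<open>i\<close>; it has norm one
by the moment condition. Following \<open>N U = U S\<close> down the trunk, the basis vector at \<open>-k\<close> goes to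
\<open>\<lambda>\<^sub>i\<^sub>,\<^sub>1 \<lambda>\<^sub>0 \<dots> \<lambda>\<^bsub>-(k - 1)\<^esub> s\<^bsup>-(k + 1)/2\<^esup>\<close> on level \<open>-k\<close> of all branches \<open>i\<close> at once. The square of
its norm is the quantity called \<open>trunk_moment k\<close> below, and the conditions (i), (ii) and (iv) say
precisely that it is one for all \<open>k < \<kappa>\<close> and at most one for \<open>k = \<kappa>\<close>. What is missing at
the root is put into an extra branch that carries the point mass at \<open>0\<close>, where \<open>N\<close> vanishes:
this leaves \<open>N U = U S\<close> intact, since no value of the shift charges the root. The images of
different basis vectors live on different levels or branches, so \<open>U\<close> is an isometry
(\<open>distr_site\<close>, \<open>lift_intertwines\<close>, \<open>subnormal_tree_shift\<close>).

Condition (iii) leads to the same norms: integrating \<open>s\<^bsup>-l\<^esup>\<close> against its two measures compares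
\<open>\<integral> s\<^bsup>\<kappa> - l\<^esup> d\<nu>\<close>, a known product of weights, with the integrals of \<open>1/s\<^bsup>l + 1\<^esup>\<close>
(\<open>trunk_moments_of_measure\<close>).

Two points concern the setting rather than the operator. The extension has to live on vectors of
type \<open>vertex \<Rightarrow> complex\<close>, so classes of functions modulo null sets are coded by their integrals
over rational rays in each fibre (\<open>coded_L2_ray_code\<close>). And the domain of the shift is dense
because it contains all basis vectors: a vertex other than \<open>0\<close> has at most one child, so its basis
vector has an image of finite support, and the one at \<open>0\<close> is in the domain by assumption.\<close>

section \<open>Square integrable functions\<close>

lemma borel_measurable_cnj [measurable (raw)]:
  "f \<in> borel_measurable M \<Longrightarrow> (\<lambda>x. cnj (f x)) \<in> borel_measurable M"
  by (rule borel_measurable_continuous_on[where f=cnj]) (auto intro: continuous_intros)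

definition L2 :: "'x measure \<Rightarrow> ('x \<Rightarrow> complex) set" where
  "L2 M = {F \<in> borel_measurable M. integrable M (\<lambda>x. (cmod (F x))\<^sup>2)}"

lemma L2_measurable [measurable_dest]: "F \<in> L2 M \<Longrightarrow> F \<in> borel_measurable M"
  by (simp add: L2_def)

lemma L2_integrable_square: "F \<in> L2 M \<Longrightarrow> integrable M (\<lambda>x. (cmod (F x))\<^sup>2)"
  by (simp add: L2_def)

lemma L2_iff_nn_integral:
  "F \<in> L2 M \<longleftrightarrow> F \<in> borel_measurable M \<and> (\<integral>\<^sup>+x. ennreal ((cmod (F x))\<^sup>2) \<partial>M) < \<infinity>"
  unfolding L2_def by (auto simp: integrable_iff_bounded)

lemma L2_dominated:
  assumes F: "F \<in> L2 M" and [measurable]: "G \<in> borel_measurable M"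
    and le: "AE x in M. cmod (G x) \<le> c * cmod (F x)"
  shows "G \<in> L2 M"
proof -
  have "integrable M (\<lambda>x. c\<^sup>2 * (cmod (F x))\<^sup>2)"
    using L2_integrable_square[OF F] by simp
  then have "integrable M (\<lambda>x. (cmod (G x))\<^sup>2)"
  proof (rule Bochner_Integration.integrable_bound)
    show "AE x in M. norm ((cmod (G x))\<^sup>2) \<le> norm (c\<^sup>2 * (cmod (F x))\<^sup>2)"
      using le
    proof eventually_elim
      case (elim x)
      then have "(cmod (G x))\<^sup>2 \<le> (c * cmod (F x))\<^sup>2"
        by (rule power_mono) simp
      then show ?case by (simp add: power_mult_distrib)
    qed
  qed measurable
  then show ?thesis by (simp add: L2_def)
qed

lemma L2_zero [simp]: "(\<lambda>x. 0) \<in> L2 M"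
  by (simp add: L2_def)

lemma L2_scale: "F \<in> L2 M \<Longrightarrow> (\<lambda>x. c * F x) \<in> L2 M"
  by (rule L2_dominated[of F _ _ "cmod c"]) (auto simp: norm_mult)

lemma L2_add:
  assumes F: "F \<in> L2 M" and G: "G \<in> L2 M"
  shows "(\<lambda>x. F x + G x) \<in> L2 M"
proof -
  note [measurable] = L2_measurable[OF F] L2_measurable[OF G]
  have "integrable M (\<lambda>x. 2 * (cmod (F x))\<^sup>2 + 2 * (cmod (G x))\<^sup>2)"
    using L2_integrable_square[OF F] L2_integrable_square[OF G] by simp
  then have "integrable M (\<lambda>x. (cmod (F x + G x))\<^sup>2)"
  proof (rule Bochner_Integration.integrable_bound)
    show "AE x in M. norm ((cmod (F x + G x))\<^sup>2) \<le> norm (2 * (cmod (F x))\<^sup>2 + 2 * (cmod (G x))\<^sup>2)"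
    proof (rule AE_I2)
      fix x
      have "(cmod (F x + G x))\<^sup>2 \<le> (cmod (F x) + cmod (G x))\<^sup>2"
        by (rule power_mono[OF norm_triangle_ineq]) simp
      also have "\<dots> \<le> 2 * (cmod (F x))\<^sup>2 + 2 * (cmod (G x))\<^sup>2"
        using sum_squares_bound[of "cmod (F x)" "cmod (G x)"] by (simp add: power2_sum)
      finally show "norm ((cmod (F x + G x))\<^sup>2) \<le> norm (2 * (cmod (F x))\<^sup>2 + 2 * (cmod (G x))\<^sup>2)"
        by simp
    qed
  qed measurable
  then show ?thesis by (simp add: L2_def)
qed

lemma L2_diff: "F \<in> L2 M \<Longrightarrow> G \<in> L2 M \<Longrightarrow> (\<lambda>x. F x - G x) \<in> L2 M"
  using L2_add[of F M "\<lambda>x. - 1 * G x"] L2_scale[of G M "- 1"] by simp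

lemma L2_cong_AE:
  "F \<in> L2 M \<Longrightarrow> G \<in> borel_measurable M \<Longrightarrow> AE x in M. G x = F x \<Longrightarrow> G \<in> L2 M"
  by (erule L2_dominated[of F _ _ 1]) auto

lemma L2_mult_integrable:
  assumes F: "F \<in> L2 M" and G: "G \<in> L2 M"
  shows "integrable M (\<lambda>x. F x * cnj (G x))"
proof -
  note [measurable] = L2_measurable[OF F] L2_measurable[OF G]
  have "integrable M (\<lambda>x. (cmod (F x))\<^sup>2 + (cmod (G x))\<^sup>2)"
    using L2_integrable_square[OF F] L2_integrable_square[OF G] by simp
  then show ?thesis
  proof (rule Bochner_Integration.integrable_bound)
    show "AE x in M. norm (F x * cnj (G x)) \<le> norm ((cmod (F x))\<^sup>2 + (cmod (G x))\<^sup>2)"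
    proof (rule AE_I2)
      fix x show "norm (F x * cnj (G x)) \<le> norm ((cmod (F x))\<^sup>2 + (cmod (G x))\<^sup>2)"
        using sum_squares_bound[of "cmod (F x)" "cmod (G x)"] 
          mult_nonneg_nonneg[of "cmod (F x)" "cmod (G x)"]
        by (simp add: norm_mult del: mult_nonneg_nonneg)
    qed
  qed measurable
qed

lemma L2_square_integral:
  "(\<integral>x. F x * cnj (F x) \<partial>M) = of_real (\<integral>x. (cmod (F x))\<^sup>2 \<partial>M)"
  by (simp only: complex_norm_square[symmetric] integral_complex_of_real)

lemma L2_square_integral_eq_0_iff:
  assumes "F \<in> L2 M"
  shows "(\<integral>x. (cmod (F x))\<^sup>2 \<partial>M) = 0 \<longleftrightarrow> (AE x in M. F x = 0)"
  using integral_nonneg_eq_0_iff_AE[OF L2_integrable_square[OF assms]] by simp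

lemma L2_Cauchy_Schwarz:
  assumes F: "F \<in> L2 M" and G: "G \<in> L2 M"
  shows "cmod (\<integral>x. F x * cnj (G x) \<partial>M)
    \<le> sqrt (\<integral>x. (cmod (F x))\<^sup>2 \<partial>M) * sqrt (\<integral>x. (cmod (G x))\<^sup>2 \<partial>M)"
proof -
  note [measurable] = L2_measurable[OF F] L2_measurable[OF G]
  let ?a = "\<integral>x. (cmod (F x))\<^sup>2 \<partial>M" and ?b = "\<integral>x. (cmod (G x))\<^sup>2 \<partial>M"
  let ?c = "\<integral>x. cmod (F x * cnj (G x)) \<partial>M"
  have int: "integrable M (\<lambda>x. cmod (F x * cnj (G x)))"
    using L2_mult_integrable[OF F G] by (rule integrable_norm)
  \<comment> \<open>Optimizing \<open>t\<close> in this inequality gives the claim; the best value is \<open>?c / ?a\<close>.\<close>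
  have quad: "2 * t * ?c \<le> t\<^sup>2 * ?a + ?b" for t
  proof -
    have "(\<integral>x. 2 * t * cmod (F x * cnj (G x)) \<partial>M) \<le> (\<integral>x. t\<^sup>2 * (cmod (F x))\<^sup>2 + (cmod (G x))\<^sup>2 \<partial>M)"
    proof (rule integral_mono)
      fix x show "2 * t * cmod (F x * cnj (G x)) \<le> t\<^sup>2 * (cmod (F x))\<^sup>2 + (cmod (G x))\<^sup>2"
        using sum_squares_bound[of "t * cmod (F x)" "cmod (G x)"]
        by (simp add: norm_mult power_mult_distrib mult.assoc)
    qed (use int L2_integrable_square[OF F] L2_integrable_square[OF G] in auto)
    also have "\<dots> = t\<^sup>2 * ?a + ?b"
      using L2_integrable_square[OF F] L2_integrable_square[OF G] by simp
    finally show ?thesis by (simp add: norm_mult)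
  qed
  have a0: "0 \<le> ?a" and b0: "0 \<le> ?b" and c0: "0 \<le> ?c" by simp_all
  have "?c\<^sup>2 \<le> ?a * ?b"
  proof (cases "?a = 0")
    case True
    then have "AE x in M. F x = 0" using L2_square_integral_eq_0_iff[OF F] by simp
    then have "?c = (\<integral>x. 0 \<partial>M)" by (intro integral_cong_AE) (measurable, auto)
    then show ?thesis using True by simp
  next
    case False
    then have "?a > 0" using a0 by linarith
    then show ?thesis using quad[of "?c / ?a"] by (simp add: field_simps power2_eq_square)
  qed
  then have "?c \<le> sqrt (?a * ?b)" using real_le_rsqrt by blast
  moreover have "cmod (\<integral>x. F x * cnj (G x) \<partial>M) \<le> ?c"
    by (rule integral_norm_bound)
  ultimately show ?thesis unfolding real_sqrt_mult by (rule order_trans[rotated])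
qed

text \<open>The bound makes the steps geometrically small, with ratio \<open>1 / sqrt 2\<close>. Squares of steps are what
an \<open>L\<^sup>2\<close> estimate controls, hence this form.\<close>

lemma convergent_if_weighted_square_steps_bounded:
  fixes z :: "nat \<Rightarrow> complex"
  assumes "\<And>k. 2 ^ k * (cmod (z (Suc k) - z k))\<^sup>2 \<le> C"
  shows "convergent z"
proof -
  have C: "0 \<le> C" using assms[of 0] by (smt (verit) mult_nonneg_nonneg zero_le_power2 zero_le_power)
  have step: "cmod (z (Suc k) - z k) \<le> sqrt C * (1 / sqrt 2) ^ k" for k
  proof -
    have "(cmod (z (Suc k) - z k))\<^sup>2 \<le> C / 2 ^ k"
      using assms[of k] by (simp add: field_simps)
    also have "\<dots> = (sqrt C * (1 / sqrt 2) ^ k)\<^sup>2"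
      using C by (simp add: power_mult_distrib power_divide power2_eq_square flip: power_mult_distrib)
    finally show ?thesis
      by (rule power2_le_imp_le) (simp add: C)
  qed
  have "summable (\<lambda>k. sqrt C * (1 / sqrt 2) ^ k)"
    by (intro summable_mult summable_geometric) (simp add: real_less_rsqrt)
  then have "summable (\<lambda>k. z (Suc k) - z k)"
    by (rule summable_comparison_test'[where N=0]) (use step in auto)
  then have "convergent (\<lambda>n. \<Sum>k<n. z (Suc k) - z k)"
    by (simp add: summable_iff_convergent)
  then have "convergent (\<lambda>n. z n - z 0)"
    by (simp add: sum_lessThan_telescope)
  then have "convergent (\<lambda>n. (z n - z 0) + z 0)"
    by (intro convergent_add convergent_const)
  then show ?thesis by simp
qed

text \<open>A subsequence whose consecutive \<open>L\<^sup>2\<close> distances squared are below \<open>4\<^bsup>-k\<^esup>\<close> remains summable after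
multiplication by \<open>2\<^sup>k\<close>, so it converges almost everywhere; Fatou's lemma transfers the Cauchy
estimate to the limit.\<close>

lemma Riesz_Fischer:
  assumes F: "\<And>n. F n \<in> L2 M"
    and cauchy: "\<And>\<epsilon>. \<epsilon> > 0 \<Longrightarrow> \<exists>N. \<forall>m\<ge>N. \<forall>n\<ge>N. (\<integral>x. (cmod (F m x - F n x))\<^sup>2 \<partial>M) < \<epsilon>"
  shows "\<exists>G\<in>L2 M. (\<lambda>n. \<integral>x. (cmod (F n x - G x))\<^sup>2 \<partial>M) \<longlonglongrightarrow> 0"
proof -
  note [measurable] = L2_measurable[OF F]
  have "\<forall>k. \<exists>N. \<forall>m\<ge>N. \<forall>n\<ge>N. (\<integral>x. (cmod (F m x - F n x))\<^sup>2 \<partial>M) < (1/4) ^ k"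
    using cauchy by simp
  then obtain N where N: "\<And>k m n. m \<ge> N k \<Longrightarrow> n \<ge> N k \<Longrightarrow> (\<integral>x. (cmod (F m x - F n x))\<^sup>2 \<partial>M) < (1/4) ^ k"
    by metis
  define r where "r k = k + (\<Sum>j\<le>k. N j)" for k
  have r_ge: "N k \<le> r k" "k \<le> r k" for k
    by (auto simp: r_def intro: trans_le_add2 member_le_sum)
  have r_Suc: "r k \<le> r (Suc k)" for k by (simp add: r_def)
  define D where "D k x = (2::real) ^ k * (cmod (F (r (Suc k)) x - F (r k) x))\<^sup>2" for k x
  have D_meas [measurable]: "D k \<in> borel_measurable M" for k unfolding D_def by measurable
  have "(\<integral>\<^sup>+x. ennreal (D k x) \<partial>M) \<le> ennreal ((1/2) ^ k)" for k
  proof -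
    have "integrable M (D k)"
      unfolding D_def using L2_integrable_square[OF L2_diff[OF F F]] by simp
    then have "(\<integral>\<^sup>+x. ennreal (D k x) \<partial>M) = ennreal (\<integral>x. D k x \<partial>M)"
      by (rule nn_integral_eq_integral) (simp add: D_def)
    also have "(\<integral>x. D k x \<partial>M) = 2 ^ k * (\<integral>x. (cmod (F (r (Suc k)) x - F (r k) x))\<^sup>2 \<partial>M)"
      by (simp add: D_def)
    also have "\<dots> \<le> 2 ^ k * (1/4) ^ k"
      using N[of k "r (Suc k)" "r k"] r_ge(1)[of k] r_Suc[of k] by (intro mult_left_mono) auto
    also have "\<dots> = (1/2) ^ k" by (simp flip: power_mult_distrib)
    finally show ?thesis by (simp add: ennreal_leI)
  qed
  then have "(\<integral>\<^sup>+x. (\<Sum>k. ennreal (D k x)) \<partial>M) \<le> (\<Sum>k. ennreal ((1/2) ^ k))"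
    by (subst nn_integral_suminf) (auto intro: suminf_le)
  also have "\<dots> < \<infinity>"
    by (subst suminf_ennreal2) auto
  finally have "AE x in M. (\<Sum>k. ennreal (D k x)) \<noteq> \<infinity>"
    by (intro nn_integral_noteq_infinite) auto
  then have conv: "AE x in M. convergent (\<lambda>k. F (r k) x)"
  proof eventually_elim
    case (elim x)
    then obtain C where C: "0 \<le> C" "(\<Sum>k. ennreal (D k x)) = ennreal C"
      by (cases "\<Sum>k. ennreal (D k x)") auto
    have "ennreal (D k x) \<le> ennreal C" for k
      unfolding C(2)[symmetric] using sum_le_suminf[of "\<lambda>k. ennreal (D k x)" "{k}"] by simp
    then have "D k x \<le> C" for k using C(1) by simp
    then show ?case
      unfolding D_def by (rule convergent_if_weighted_square_steps_bounded)
  qed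
  define G where "G x = lim (\<lambda>k. F (r k) x)" for x
  have G_meas [measurable]: "G \<in> borel_measurable M"
    unfolding G_def by (rule borel_measurable_lim_metric) measurable
  have lim: "AE x in M. (\<lambda>k. F (r k) x) \<longlonglongrightarrow> G x"
    using conv by eventually_elim (simp add: G_def convergent_LIMSEQ_iff)
  have bound: "(\<integral>\<^sup>+x. ennreal ((cmod (F n x - G x))\<^sup>2) \<partial>M) \<le> ennreal \<epsilon>"
    if "\<forall>m\<ge>N0. \<forall>n\<ge>N0. (\<integral>x. (cmod (F m x - F n x))\<^sup>2 \<partial>M) < \<epsilon>" "n \<ge> N0" for \<epsilon> N0 n
  proof -
    have "(\<integral>\<^sup>+x. ennreal ((cmod (F n x - G x))\<^sup>2) \<partial>M)
      = (\<integral>\<^sup>+x. liminf (\<lambda>k. ennreal ((cmod (F n x - F (r k) x))\<^sup>2)) \<partial>M)"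
    proof (rule nn_integral_cong_AE)
      show "AE x in M. ennreal ((cmod (F n x - G x))\<^sup>2) = liminf (\<lambda>k. ennreal ((cmod (F n x - F (r k) x))\<^sup>2))"
        using lim
      proof eventually_elim
        case (elim x)
        have "(\<lambda>k. ennreal ((cmod (F n x - F (r k) x))\<^sup>2)) \<longlonglongrightarrow> ennreal ((cmod (F n x - G x))\<^sup>2)"
          by (intro tendsto_intros elim)
        then show ?case by (rule lim_imp_Liminf[OF sequentially_bot, symmetric])
      qed
    qed
    also have "\<dots> \<le> liminf (\<lambda>k. \<integral>\<^sup>+x. ennreal ((cmod (F n x - F (r k) x))\<^sup>2) \<partial>M)"
      by (rule nn_integral_liminf) measurable
    also have "\<dots> \<le> ennreal \<epsilon>"
    proof (rule Liminf_le)
      show "\<forall>\<^sub>F k in sequentially. (\<integral>\<^sup>+x. ennreal ((cmod (F n x - F (r k) x))\<^sup>2) \<partial>M) \<le> ennreal \<epsilon>"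
        unfolding eventually_sequentially
      proof (intro exI allI impI)
        fix k assume "N0 \<le> k"
        then have "(\<integral>x. (cmod (F n x - F (r k) x))\<^sup>2 \<partial>M) < \<epsilon>"
          using that r_ge(2)[of k] by (meson order_trans)
        then show "(\<integral>\<^sup>+x. ennreal ((cmod (F n x - F (r k) x))\<^sup>2) \<partial>M) \<le> ennreal \<epsilon>"
          using L2_integrable_square[OF L2_diff[OF F F]]
          by (subst nn_integral_eq_integral) (auto intro: ennreal_leI)
      qed
    qed simp
    finally show ?thesis .
  qed
  have diff: "\<exists>n. (\<lambda>x. F n x - G x) \<in> L2 M"
  proof -
    obtain N0 where N0: "\<forall>m\<ge>N0. \<forall>n\<ge>N0. (\<integral>x. (cmod (F m x - F n x))\<^sup>2 \<partial>M) < 1"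
      using cauchy[of 1] by auto
    have "(\<integral>\<^sup>+x. ennreal ((cmod (F N0 x - G x))\<^sup>2) \<partial>M) < \<infinity>"
      using bound[OF N0, of N0] by (simp add: le_less_trans[OF _ ennreal_one_less_top])
    then show ?thesis by (auto simp: L2_iff_nn_integral)
  qed
  then obtain n0 where "(\<lambda>x. F n0 x - G x) \<in> L2 M" by auto
  then have G: "G \<in> L2 M" using L2_diff[OF F[of n0]] by fastforce
  moreover have "(\<lambda>n. \<integral>x. (cmod (F n x - G x))\<^sup>2 \<partial>M) \<longlonglongrightarrow> 0"
  proof (rule LIMSEQ_I)
    fix e :: real assume e: "0 < e"
    obtain N0 where N0: "\<forall>m\<ge>N0. \<forall>n\<ge>N0. (\<integral>x. (cmod (F m x - F n x))\<^sup>2 \<partial>M) < e / 2"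
      using cauchy[of "e / 2"] e by auto
    show "\<exists>no. \<forall>n\<ge>no. norm ((\<integral>x. (cmod (F n x - G x))\<^sup>2 \<partial>M) - 0) < e"
    proof (intro exI allI impI)
      fix n assume "N0 \<le> n"
      from bound[OF N0 this] have "(\<integral>x. (cmod (F n x - G x))\<^sup>2 \<partial>M) \<le> e / 2"
        using e L2_integrable_square[OF L2_diff[OF F G]] by (subst (asm) nn_integral_eq_integral) auto
      then show "norm ((\<integral>x. (cmod (F n x - G x))\<^sup>2 \<partial>M) - 0) < e" using e by simp
    qed
  qed
  ultimately show ?thesis by blast
qed

section \<open>A Hilbert space of coded classes of square integrable functions\<close>

lemma cring_complex_field: "cring complex_field"
proof (rule cringI)
  show "abelian_group complex_field"
    by (rule abelian_groupI) (auto simp: complex_field_def intro: exI[of _ "- x" for x])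
  show "comm_monoid complex_field"
    by (rule comm_monoidI) (auto simp: complex_field_def)
qed (auto simp: complex_field_def distrib_right)

text \<open>The Hilbert space \<open>L\<^sup>2(M)\<close> consists of classes modulo null sets. Any map \<open>code\<close> with exactly these
classes as its fibres lets its values stand for them, which realizes the space on a
prescribed type of vectors.\<close>

locale coded_L2 =
  fixes M :: "'x measure" and code :: "('x \<Rightarrow> complex) \<Rightarrow> 'b"
  assumes code_eq_iff:
    "F \<in> L2 M \<Longrightarrow> G \<in> L2 M \<Longrightarrow> code F = code G \<longleftrightarrow> (AE x in M. F x = G x)"
begin

definition rep :: "'b \<Rightarrow> 'x \<Rightarrow> complex" where
  "rep b = (SOME F. F \<in> L2 M \<and> code F = b)"

definition space_L2 :: "'b inner_space" where
  "space_L2 =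
     \<lparr>carrier = code ` L2 M,
      mult = undefined,
      one = undefined,
      zero = code (\<lambda>x. 0),
      add = (\<lambda>a b. code (\<lambda>x. rep a x + rep b x)),
      smult = (\<lambda>c a. code (\<lambda>x. c * rep a x)),
      inner_prod = (\<lambda>a b. \<integral>x. rep a x * cnj (rep b x) \<partial>M)\<rparr>"

lemma rep_code:
  assumes "F \<in> L2 M"
  shows "rep (code F) \<in> L2 M" "AE x in M. rep (code F) x = F x"
proof -
  have "rep (code F) \<in> L2 M \<and> code (rep (code F)) = code F"
    unfolding rep_def by (rule someI[where x=F]) (use assms in simp)
  then show "rep (code F) \<in> L2 M" "AE x in M. rep (code F) x = F x"
    using code_eq_iff assms by blast+
qed

lemma carrier_L2: "carrier space_L2 = code ` L2 M"
  by (simp add: space_L2_def)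

lemma zero_L2: "\<zero>\<^bsub>space_L2\<^esub> = code (\<lambda>x. 0)"
  by (simp add: space_L2_def)

lemma add_code:
  assumes F: "F \<in> L2 M" and G: "G \<in> L2 M"
  shows "code F \<oplus>\<^bsub>space_L2\<^esub> code G = code (\<lambda>x. F x + G x)"
  unfolding space_L2_def
  using rep_code[OF F] rep_code[OF G] F G
  by (auto simp: code_eq_iff L2_add)

lemma smult_code:
  assumes F: "F \<in> L2 M"
  shows "c \<odot>\<^bsub>space_L2\<^esub> code F = code (\<lambda>x. c * F x)"
  unfolding space_L2_def
  using rep_code[OF F] F by (auto simp: code_eq_iff L2_scale)

lemma inner_code:
  assumes F: "F \<in> L2 M" and G: "G \<in> L2 M"
  shows "inner_prod space_L2 (code F) (code G) = (\<integral>x. F x * cnj (G x) \<partial>M)"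
proof -
  note [measurable] = L2_measurable[OF F] L2_measurable[OF G]
    L2_measurable[OF rep_code(1)[OF F]] L2_measurable[OF rep_code(1)[OF G]]
  show ?thesis
    unfolding space_L2_def
    by (simp, rule integral_cong_AE) (use rep_code(2)[OF F] rep_code(2)[OF G] in auto)
qed

lemmas code_simps = carrier_L2 zero_L2 add_code smult_code inner_code L2_add L2_scale L2_diff

lemma abelian_group_L2: "abelian_group space_L2"
proof (rule abelian_groupI)
  fix a assume "a \<in> carrier space_L2"
  then obtain F where F: "F \<in> L2 M" "a = code F" by (auto simp: carrier_L2)
  then have "code (\<lambda>x. - 1 * F x) \<in> carrier space_L2"
    "code (\<lambda>x. - 1 * F x) \<oplus>\<^bsub>space_L2\<^esub> a = \<zero>\<^bsub>space_L2\<^esub>"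
    using L2_scale[OF F(1), of "- 1"] by (auto simp: code_simps)
  then show "\<exists>b\<in>carrier space_L2. b \<oplus>\<^bsub>space_L2\<^esub> a = \<zero>\<^bsub>space_L2\<^esub>" by blast
qed (auto simp: code_simps algebra_simps)

lemma minus_code:
  assumes F: "F \<in> L2 M" and G: "G \<in> L2 M"
  shows "code F \<ominus>\<^bsub>space_L2\<^esub> code G = code (\<lambda>x. F x - G x)"
proof -
  have G': "(\<lambda>x. - G x) \<in> L2 M" using L2_scale[OF G, of "- 1"] by simp
  interpret abelian_group space_L2 by (rule abelian_group_L2)
  have "\<ominus>\<^bsub>space_L2\<^esub> code G = code (\<lambda>x. - G x)"
    by (rule minus_equality) (use G G' in \<open>auto simp: code_simps\<close>)
  then show ?thesis
    using F G' by (simp add: a_minus_def code_simps)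
qed

lemma hnorm_code: "F \<in> L2 M \<Longrightarrow> hnorm space_L2 (code F) = sqrt (\<integral>x. (cmod (F x))\<^sup>2 \<partial>M)"
  by (simp add: hnorm_def inner_code L2_square_integral)

lemma hdist_code:
  "F \<in> L2 M \<Longrightarrow> G \<in> L2 M \<Longrightarrow>
    hdist space_L2 (code F) (code G) = sqrt (\<integral>x. (cmod (F x - G x))\<^sup>2 \<partial>M)"
  by (simp add: hdist_def minus_code hnorm_code L2_diff)

lemma inner_product_space_L2: "inner_product_space space_L2"
  unfolding inner_product_space_def
proof (intro conjI ballI allI impI)
  interpret C: cring complex_field by (rule cring_complex_field)
  interpret A: abelian_group space_L2 by (rule abelian_group_L2)
  show "Module.module complex_field space_L2"
    by unfold_locales (auto simp: code_simps complex_field_def algebra_simps)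
next
  fix a b c assume "a \<in> carrier space_L2" "b \<in> carrier space_L2" "c \<in> carrier space_L2"
  then show "inner_prod space_L2 (a \<oplus>\<^bsub>space_L2\<^esub> b) c
    = inner_prod space_L2 a c + inner_prod space_L2 b c"
    using L2_mult_integrable[where M=M] by (auto simp: code_simps distrib_right)
next
  fix c a b assume "a \<in> carrier space_L2" "b \<in> carrier space_L2"
  then show "inner_prod space_L2 (c \<odot>\<^bsub>space_L2\<^esub> a) b = c * inner_prod space_L2 a b"
    by (auto simp: code_simps mult.assoc)
next
  fix a b assume "a \<in> carrier space_L2" "b \<in> carrier space_L2"
  then show "inner_prod space_L2 b a = cnj (inner_prod space_L2 a b)"
    by (auto simp: code_simps mult.commute simp flip: Bochner_Integration.integral_cnj)
next
  fix a assume "a \<in> carrier space_L2" "a \<noteq> \<zero>\<^bsub>space_L2\<^esub>"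
  then obtain F where F: "F \<in> L2 M" "a = code F" "\<not> (AE x in M. F x = 0)"
    by (auto simp: carrier_L2 zero_L2 code_eq_iff)
  then have "(\<integral>x. (cmod (F x))\<^sup>2 \<partial>M) \<noteq> 0"
    by (simp add: L2_square_integral_eq_0_iff)
  moreover have "(\<integral>x. (cmod (F x))\<^sup>2 \<partial>M) \<ge> 0" by simp
  ultimately show "0 < Re (inner_prod space_L2 a a)"
    unfolding F(2) inner_code[OF F(1) F(1)] L2_square_integral Re_complex_of_real by linarith
qed

lemma hilbert_space_L2: "hilbert_space space_L2"
  unfolding hilbert_space_def
proof (intro conjI allI impI inner_product_space_L2)
  fix s :: "nat \<Rightarrow> 'b"
  assume s: "(\<forall>n. s n \<in> carrier space_L2) \<and>
    (\<forall>\<epsilon>>0. \<exists>N. \<forall>m\<ge>N. \<forall>n\<ge>N. hdist space_L2 (s m) (s n) < \<epsilon>)"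
  then have "\<forall>n. \<exists>F. F \<in> L2 M \<and> s n = code F" by (auto simp: carrier_L2)
  then obtain F where F: "\<And>n. F n \<in> L2 M" "\<And>n. s n = code (F n)" by metis
  have "\<exists>N. \<forall>m\<ge>N. \<forall>n\<ge>N. (\<integral>x. (cmod (F m x - F n x))\<^sup>2 \<partial>M) < \<epsilon>" if "\<epsilon> > 0" for \<epsilon>
  proof -
    obtain N where N: "\<forall>m\<ge>N. \<forall>n\<ge>N. hdist space_L2 (s m) (s n) < sqrt \<epsilon>"
      using s \<open>\<epsilon> > 0\<close> real_sqrt_gt_zero by blast
    then show ?thesis
      by (auto simp: F hdist_code)
  qed
  then obtain G where G: "G \<in> L2 M" "(\<lambda>n. \<integral>x. (cmod (F n x - G x))\<^sup>2 \<partial>M) \<longlonglongrightarrow> 0"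
    using Riesz_Fischer[of F M] F by blast
  have "(\<lambda>n. hdist space_L2 (s n) (code G)) \<longlonglongrightarrow> 0"
    using tendsto_real_sqrt[OF G(2)] by (simp add: F G hdist_code)
  then show "\<exists>x\<in>carrier space_L2. (\<lambda>n. hdist space_L2 (s n) x) \<longlonglongrightarrow> 0"
    using G by (auto simp: carrier_L2)
qed

text \<open>Continuity of the inner product, which makes graphs of adjoints closed.\<close>

lemma inner_code_LIMSEQ:
  assumes F: "\<And>n. F n \<in> L2 M" and F': "F' \<in> L2 M" and G: "G \<in> L2 M"
    and lim: "(\<lambda>n. hdist space_L2 (code (F n)) (code F')) \<longlonglongrightarrow> 0"
  shows "(\<lambda>n. \<integral>x. F n x * cnj (G x) \<partial>M) \<longlonglongrightarrow> (\<integral>x. F' x * cnj (G x) \<partial>M)"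
proof -
  have "(\<lambda>n. (\<integral>x. F n x * cnj (G x) \<partial>M) - (\<integral>x. F' x * cnj (G x) \<partial>M)) \<longlonglongrightarrow> 0"
  proof (rule Lim_null_comparison)
    show "(\<lambda>n. hdist space_L2 (code (F n)) (code F') * sqrt (\<integral>x. (cmod (G x))\<^sup>2 \<partial>M)) \<longlonglongrightarrow> 0"
      using tendsto_mult_right[OF lim] by simp
    show "\<forall>\<^sub>F n in sequentially. norm ((\<integral>x. F n x * cnj (G x) \<partial>M) - (\<integral>x. F' x * cnj (G x) \<partial>M))
      \<le> hdist space_L2 (code (F n)) (code F') * sqrt (\<integral>x. (cmod (G x))\<^sup>2 \<partial>M)"
    proof (intro always_eventually allI)
      fix n
      have "(\<integral>x. F n x * cnj (G x) \<partial>M) - (\<integral>x. F' x * cnj (G x) \<partial>M)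
        = (\<integral>x. (F n x - F' x) * cnj (G x) \<partial>M)"
        by (simp add: left_diff_distrib L2_mult_integrable F F' G)
      then show "norm ((\<integral>x. F n x * cnj (G x) \<partial>M) - (\<integral>x. F' x * cnj (G x) \<partial>M))
        \<le> hdist space_L2 (code (F n)) (code F') * sqrt (\<integral>x. (cmod (G x))\<^sup>2 \<partial>M)"
        using L2_Cauchy_Schwarz[OF L2_diff[OF F F'] G] by (simp add: hdist_code F F')
    qed
  qed
  then show ?thesis by (rule LIM_zero_cancel)
qed

end

section \<open>Weighted translations are normal\<close>

text \<open>Because \<open>g\<close> is invariant under the measure preserving bijection \<open>T\<close>, composition with \<open>T\<close> is a
unitary operator that commutes with multiplication by \<open>g\<close>. The locale is symmetric in \<open>T\<close> and its
inverse \<open>T'\<close>; this lets facts about the operator be reused for its adjoint.\<close>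

locale weighted_translation = coded_L2 M code
  for M :: "'x measure" and code :: "('x \<Rightarrow> complex) \<Rightarrow> 'b" +
  fixes T T' :: "'x \<Rightarrow> 'x" and g :: "'x \<Rightarrow> real"
  assumes T_measurable [measurable]: "T \<in> measurable M M"
    and T'_measurable [measurable]: "T' \<in> measurable M M"
    and T_T': "\<And>x. T (T' x) = x"
    and T'_T: "\<And>x. T' (T x) = x"
    and distr_T: "distr M M T = M"
    and distr_T': "distr M M T' = M"
    and g_measurable [measurable]: "g \<in> borel_measurable M"
    and g_T: "\<And>x. g (T x) = g x"
begin

definition translation_op :: "('b \<times> 'b) set" where
  "translation_op =
     {(code F, code (\<lambda>x. of_real (g x) * F (T x))) | F.
        F \<in> L2 M \<and> (\<lambda>x. of_real (g x) * F (T x)) \<in> L2 M}"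

lemma g_T': "g (T' x) = g x"
  using g_T[of "T' x"] by (simp add: T_T')

lemma inverse_translation: "weighted_translation M code T' T g"
  by unfold_locales (auto simp: T_T' T'_T distr_T distr_T' g_T')

lemma AE_T: "AE x in M. P x \<Longrightarrow> AE x in M. P (T x)"
  using AE_distrD[OF T_measurable, of P] unfolding distr_T .

lemma integral_T:
  fixes h :: "'x \<Rightarrow> complex"
  assumes "h \<in> borel_measurable M"
  shows "(\<integral>x. h (T x) \<partial>M) = (\<integral>x. h x \<partial>M)"
  using integral_distr[OF T_measurable assms] by (simp add: distr_T)

lemma L2_T:
  assumes "F \<in> L2 M"
  shows "(\<lambda>x. F (T x)) \<in> L2 M"
proof -
  note [measurable] = L2_measurable[OF assms]
  have "integrable (distr M M T) (\<lambda>x. (cmod (F x))\<^sup>2)"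
    using L2_integrable_square[OF assms] by (simp add: distr_T)
  then have "integrable M (\<lambda>x. (cmod (F (T x)))\<^sup>2)"
    by (subst (asm) integrable_distr_eq) measurable
  then show ?thesis by (simp add: L2_def)
qed

lemma translation_op_iff:
  assumes F: "F \<in> L2 M"
  shows "(code F, b) \<in> translation_op \<longleftrightarrow>
    (\<lambda>x. of_real (g x) * F (T x)) \<in> L2 M \<and> b = code (\<lambda>x. of_real (g x) * F (T x))"
proof
  assume "(code F, b) \<in> translation_op"
  then obtain F' where F': "F' \<in> L2 M" "code F' = code F"
    "(\<lambda>x. of_real (g x) * F' (T x)) \<in> L2 M" "b = code (\<lambda>x. of_real (g x) * F' (T x))"
    by (force simp: translation_op_def)
  note [measurable] = L2_measurable[OF F]
  have "AE x in M. F' x = F x" using F' F by (simp add: code_eq_iff)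
  from AE_T[OF this] have *: "AE x in M. of_real (g x) * F (T x) = of_real (g x) * F' (T x)"
    by eventually_elim simp
  then have L2: "(\<lambda>x. of_real (g x) * F (T x)) \<in> L2 M"
    by (intro L2_cong_AE[OF F'(3)]) auto
  moreover have "code (\<lambda>x. of_real (g x) * F (T x)) = code (\<lambda>x. of_real (g x) * F' (T x))"
    using * code_eq_iff[OF L2 F'(3)] by blast
  ultimately show "(\<lambda>x. of_real (g x) * F (T x)) \<in> L2 M \<and> b = code (\<lambda>x. of_real (g x) * F (T x))"
    by (simp add: F'(4))
qed (use F in \<open>auto simp: translation_op_def\<close>)

lemma linear_operator_translation: "linear_operator space_L2 translation_op"
  unfolding linear_operator_def
proof (intro conjI)
  show "translation_op \<subseteq> carrier space_L2 \<times> carrier space_L2"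
    by (auto simp: translation_op_def carrier_L2)
  show "single_valued translation_op"
    unfolding single_valued_def
  proof (intro allI impI)
    fix a b c assume a: "(a, b) \<in> translation_op" and c: "(a, c) \<in> translation_op"
    then obtain F where "F \<in> L2 M" "a = code F" by (auto simp: translation_op_def)
    then show "b = c" using a c by (simp add: translation_op_iff)
  qed
  show "(\<zero>\<^bsub>space_L2\<^esub>, \<zero>\<^bsub>space_L2\<^esub>) \<in> translation_op"
    by (simp add: zero_L2 translation_op_iff)
  show "\<forall>(x, y)\<in>translation_op. \<forall>(x', y')\<in>translation_op.
    (x \<oplus>\<^bsub>space_L2\<^esub> x', y \<oplus>\<^bsub>space_L2\<^esub> y') \<in> translation_op"
  proof clarify
    fix a b a' b' assume "(a, b) \<in> translation_op" "(a', b') \<in> translation_op"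
    then obtain F G where FG: "F \<in> L2 M" "(\<lambda>x. of_real (g x) * F (T x)) \<in> L2 M"
      "a = code F" "b = code (\<lambda>x. of_real (g x) * F (T x))"
      "G \<in> L2 M" "(\<lambda>x. of_real (g x) * G (T x)) \<in> L2 M"
      "a' = code G" "b' = code (\<lambda>x. of_real (g x) * G (T x))"
      unfolding translation_op_def by blast
    then show "(a \<oplus>\<^bsub>space_L2\<^esub> a', b \<oplus>\<^bsub>space_L2\<^esub> b') \<in> translation_op"
      using L2_add[OF FG(2,6)] by (simp add: translation_op_iff add_code L2_add distrib_left)
  qed
  show "\<forall>c. \<forall>(x, y)\<in>translation_op. (c \<odot>\<^bsub>space_L2\<^esub> x, c \<odot>\<^bsub>space_L2\<^esub> y) \<in> translation_op"
  proof clarify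
    fix c a b assume "(a, b) \<in> translation_op"
    then obtain F where F: "F \<in> L2 M" "(\<lambda>x. of_real (g x) * F (T x)) \<in> L2 M"
      "a = code F" "b = code (\<lambda>x. of_real (g x) * F (T x))"
      unfolding translation_op_def by blast
    then show "(c \<odot>\<^bsub>space_L2\<^esub> a, c \<odot>\<^bsub>space_L2\<^esub> b) \<in> translation_op"
      using L2_scale[OF F(2), of c]
      by (simp add: translation_op_iff smult_code L2_scale mult.left_commute)
  qed
qed

lemma L2_indicator:
  assumes F: "F \<in> L2 M" and [measurable]: "Measurable.pred M P"
  shows "(\<lambda>x. if P x then F x else 0) \<in> L2 M"
  using L2_measurable[OF F] by (intro L2_dominated[OF F, of _ 1]) auto

text \<open>Cutting off where \<open>g\<close> is large gives enough vectors in the domain, both for its density and for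
the computation of the adjoint.\<close>

lemma truncation_in_domain:
  fixes c :: real
  assumes F: "F \<in> L2 M"
  defines "H \<equiv> \<lambda>x. if \<bar>g x\<bar> \<le> c then F x else 0"
  shows "H \<in> L2 M" "(\<lambda>x. of_real (g x) * H (T x)) \<in> L2 M"
proof -
  show H: "H \<in> L2 M" unfolding H_def by (rule L2_indicator[OF F]) measurable
  note [measurable] = L2_measurable[OF F]
  show "(\<lambda>x. of_real (g x) * H (T x)) \<in> L2 M"
    by (rule L2_dominated[OF L2_T[OF H], of _ c])
      (auto simp: H_def g_T norm_mult intro!: AE_I2 mult_right_mono)
qed

lemma densely_defined_translation: "densely_defined space_L2 translation_op"
  unfolding densely_defined_def
proof (intro ballI allI impI)
  fix a and \<epsilon> :: real assume "a \<in> carrier space_L2" and \<epsilon>: "0 < \<epsilon>"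
  then obtain F where F: "F \<in> L2 M" "a = code F" by (auto simp: carrier_L2)
  note [measurable] = L2_measurable[OF F(1)]
  define H where "H n x = (if \<bar>g x\<bar> \<le> real n then F x else 0)" for n x
  have H: "H n \<in> L2 M" "(\<lambda>x. of_real (g x) * H n (T x)) \<in> L2 M" for n
    using truncation_in_domain[OF F(1)] by (auto simp: H_def[abs_def])
  have "(\<lambda>n. \<integral>x. (cmod (H n x - F x))\<^sup>2 \<partial>M) \<longlonglongrightarrow> (\<integral>x. 0 \<partial>M)"
  proof (rule integral_dominated_convergence[where w="\<lambda>x. (cmod (F x))\<^sup>2"])
    show "AE x in M. (\<lambda>n. (cmod (H n x - F x))\<^sup>2) \<longlonglongrightarrow> 0"
    proof (rule AE_I2)
      fix x
      \<comment> \<open>At each point the truncations are eventually constant.\<close>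
      obtain n0 where "\<bar>g x\<bar> \<le> real n0" using real_arch_simple by blast
      then have "\<forall>\<^sub>F n in sequentially. (cmod (H n x - F x))\<^sup>2 = 0"
        unfolding eventually_sequentially H_def by (intro exI[of _ n0]) auto
      then show "(\<lambda>n. (cmod (H n x - F x))\<^sup>2) \<longlonglongrightarrow> 0"
        by (rule tendsto_eventually)
    qed
  qed (use L2_integrable_square[OF F(1)] in \<open>auto simp: H_def\<close>)
  then have "(\<lambda>n. hdist space_L2 (code (H n)) a) \<longlonglongrightarrow> 0"
    by (auto simp: F hdist_code H dest: tendsto_real_sqrt)
  from order_tendstoD(2)[OF this \<epsilon>] have "\<exists>n. hdist space_L2 (code (H n)) a < \<epsilon>"
    by (auto simp: eventually_sequentially)
  moreover have "code (H n) \<in> Domain translation_op" for n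
    using H by (auto simp: translation_op_def)
  ultimately show "\<exists>y\<in>Domain translation_op. hdist space_L2 y a < \<epsilon>" by blast
qed

lemma translation_op_swap:
  assumes F: "F \<in> L2 M" and G: "G \<in> L2 M"
  shows "(\<integral>x. (of_real (g x) * F (T x)) * cnj (G x) \<partial>M)
    = (\<integral>x. F x * cnj (of_real (g x) * G (T' x)) \<partial>M)"
proof -
  note [measurable] = L2_measurable[OF F] L2_measurable[OF G]
  show ?thesis
    by (subst integral_T[symmetric, of "\<lambda>x. F x * cnj (of_real (g x) * G (T' x))"])
      (auto simp: g_T T'_T mult.assoc mult.left_commute)
qed

text \<open>If \<open>(G, Z)\<close> is in the graph of the adjoint, put \<open>W = Z - g (G \<circ> T')\<close>. The truncation of \<open>W\<close> to
\<open>\<bar>g\<bar> \<le> m\<close> lies in the domain of the operator, and testing the adjoint equation with it yields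
\<open>\<integral> \<bar>W\<bar>\<^sup>2 = 0\<close> over that set.\<close>

lemma adjoint_translation:
  "adjoint space_L2 translation_op = weighted_translation.translation_op M code T' g"
proof -
  interpret I: weighted_translation M code T' T g by (rule inverse_translation)
  show ?thesis
  proof (intro equalityI subsetI; clarify)
    fix b c assume bc: "(b, c) \<in> adjoint space_L2 translation_op"
    then obtain G Z where GZ: "G \<in> L2 M" "b = code G" "Z \<in> L2 M" "c = code Z"
      by (auto simp: adjoint_def carrier_L2)
    note [measurable] = L2_measurable[OF GZ(1)] L2_measurable[OF GZ(3)]
    define W where "W x = Z x - of_real (g x) * G (T' x)" for x
    have [measurable]: "W \<in> borel_measurable M" unfolding W_def by measurable
    have vanish: "AE x in M. \<bar>g x\<bar> \<le> real m \<longrightarrow> W x = 0" for m :: nat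
    proof -
      define B where "B F x = (if \<bar>g x\<bar> \<le> real m then F x else 0)" for F :: "'x \<Rightarrow> complex" and x
      have BZ: "B Z \<in> L2 M"
        using truncation_in_domain(1)[OF GZ(3)] by (simp add: B_def[abs_def])
      have BG: "(\<lambda>x. of_real (g x) * B G (T' x)) \<in> L2 M"
        using I.truncation_in_domain(2)[OF GZ(1)] by (simp add: B_def[abs_def])
      have BW_eq: "B W = (\<lambda>x. B Z x - of_real (g x) * B G (T' x))"
        by (auto simp: B_def W_def g_T' fun_eq_iff)
      have BW: "B W \<in> L2 M" unfolding BW_eq by (rule L2_diff[OF BZ BG])
      have D: "(\<lambda>x. of_real (g x) * B W (T x)) \<in> L2 M"
        using truncation_in_domain(2)[OF BW, of "real m"] by (simp add: B_def cong: if_cong)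
      have "(code (B W), code (\<lambda>x. of_real (g x) * B W (T x))) \<in> translation_op"
        using BW D by (auto simp: translation_op_def)
      then have "(\<integral>x. (of_real (g x) * B W (T x)) * cnj (G x) \<partial>M) = (\<integral>x. B W x * cnj (Z x) \<partial>M)"
        using bc by (auto simp: adjoint_def GZ inner_code BW D)
      moreover have "(\<integral>x. (of_real (g x) * B W (T x)) * cnj (G x) \<partial>M)
        = (\<integral>x. B W x * cnj (of_real (g x) * B G (T' x)) \<partial>M)"
        unfolding translation_op_swap[OF BW GZ(1)]
        by (rule Bochner_Integration.integral_cong) (auto simp: B_def g_T')
      moreover have "(\<integral>x. B W x * cnj (Z x) \<partial>M) = (\<integral>x. B W x * cnj (B Z x) \<partial>M)"
        by (rule Bochner_Integration.integral_cong) (auto simp: B_def)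
      ultimately have "(\<integral>x. B W x * cnj (B Z x) - B W x * cnj (of_real (g x) * B G (T' x)) \<partial>M) = 0"
        using L2_mult_integrable[OF BW BZ] L2_mult_integrable[OF BW BG]
        by (subst Bochner_Integration.integral_diff) auto
      then have "(\<integral>x. B W x * cnj (B W x) \<partial>M) = 0"
        unfolding BW_eq by (simp add: algebra_simps)
      then have "AE x in M. B W x = 0"
        using L2_square_integral_eq_0_iff[OF BW] by (simp add: L2_square_integral del: complex_cnj_mult)
      then show ?thesis by eventually_elim (auto simp: B_def split: if_splits)
    qed
    have "AE x in M. \<forall>m::nat. \<bar>g x\<bar> \<le> real m \<longrightarrow> W x = 0"
      using vanish by (subst AE_all_countable) auto
    then have ae: "AE x in M. of_real (g x) * G (T' x) = Z x"
      by eventually_elim (metis W_def real_arch_simple right_minus_eq)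
    then have "(\<lambda>x. of_real (g x) * G (T' x)) \<in> L2 M"
      by (intro L2_cong_AE[OF GZ(3)]) auto
    then show "(b, c) \<in> I.translation_op"
      using ae GZ by (auto simp: I.translation_op_iff code_eq_iff)
  next
    fix b c assume "(b, c) \<in> I.translation_op"
    then obtain G where G: "G \<in> L2 M" "(\<lambda>x. of_real (g x) * G (T' x)) \<in> L2 M"
      "b = code G" "c = code (\<lambda>x. of_real (g x) * G (T' x))"
      unfolding I.translation_op_def by blast
    then show "(b, c) \<in> adjoint space_L2 translation_op"
      using translation_op_swap[OF _ G(1)]
      by (auto simp: adjoint_def translation_op_def carrier_L2 inner_code)
  qed
qed

lemma closed_adjoint_translation:
  "closed_operator space_L2 (adjoint space_L2 translation_op)"
  unfolding closed_operator_def
proof (intro allI ballI impI)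
  fix s t :: "nat \<Rightarrow> 'b" and a b
  assume a: "a \<in> carrier space_L2" and b: "b \<in> carrier space_L2"
    and st: "(\<forall>n. (s n, t n) \<in> adjoint space_L2 translation_op) \<and>
      (\<lambda>n. hdist space_L2 (s n) a) \<longlonglongrightarrow> 0 \<and> (\<lambda>n. hdist space_L2 (t n) b) \<longlonglongrightarrow> 0"
  have "\<forall>n. \<exists>F G. F \<in> L2 M \<and> G \<in> L2 M \<and> s n = code F \<and> t n = code G"
    using st by (fastforce simp: adjoint_def carrier_L2)
  then obtain F G where FG: "\<And>n. F n \<in> L2 M" "\<And>n. G n \<in> L2 M"
    "\<And>n. s n = code (F n)" "\<And>n. t n = code (G n)" by metis
  obtain F' G' where FG': "F' \<in> L2 M" "G' \<in> L2 M" "a = code F'" "b = code G'"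
    using a b by (auto simp: carrier_L2)
  have "(\<integral>x. (of_real (g x) * X (T x)) * cnj (F' x) \<partial>M) = (\<integral>x. X x * cnj (G' x) \<partial>M)"
    if X: "X \<in> L2 M" and Y: "(\<lambda>x. of_real (g x) * X (T x)) \<in> L2 M" for X
  proof -
    define Y where "Y = (\<lambda>x. of_real (g x) * X (T x))"
    have Y: "Y \<in> L2 M" and XY: "(code X, code Y) \<in> translation_op"
      using X Y by (auto simp: Y_def translation_op_def)
    have "(\<lambda>n. \<integral>x. F n x * cnj (Y x) \<partial>M) \<longlonglongrightarrow> (\<integral>x. F' x * cnj (Y x) \<partial>M)"
      by (rule inner_code_LIMSEQ) (use st FG FG' Y in auto)
    from tendsto_cnj[OF this]
    have 1: "(\<lambda>n. \<integral>x. Y x * cnj (F n x) \<partial>M) \<longlonglongrightarrow> (\<integral>x. Y x * cnj (F' x) \<partial>M)"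
      by (simp add: mult.commute flip: Bochner_Integration.integral_cnj)
    have "(\<lambda>n. \<integral>x. G n x * cnj (X x) \<partial>M) \<longlonglongrightarrow> (\<integral>x. G' x * cnj (X x) \<partial>M)"
      by (rule inner_code_LIMSEQ) (use st FG FG' X in auto)
    from tendsto_cnj[OF this]
    have 2: "(\<lambda>n. \<integral>x. X x * cnj (G n x) \<partial>M) \<longlonglongrightarrow> (\<integral>x. X x * cnj (G' x) \<partial>M)"
      by (simp add: mult.commute flip: Bochner_Integration.integral_cnj)
    have "(\<integral>x. Y x * cnj (F n x) \<partial>M) = (\<integral>x. X x * cnj (G n x) \<partial>M)" for n
    proof -
      have "(code (F n), code (G n)) \<in> adjoint space_L2 translation_op"
        using st by (simp add: FG(3,4))
      then have "inner_prod space_L2 (code Y) (code (F n)) = inner_prod space_L2 (code X) (code (G n))"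
        using XY unfolding adjoint_def by blast
      then show ?thesis using FG(1,2)[of n] X Y by (simp add: inner_code)
    qed
    then show ?thesis using 1 2 LIMSEQ_unique unfolding Y_def by simp
  qed
  then show "(a, b) \<in> adjoint space_L2 translation_op"
    using FG' by (auto simp: adjoint_def carrier_L2 translation_op_def inner_code)
qed

text \<open>By symmetry the operator is itself an adjoint, namely of the inverse translation.\<close>

lemma closed_translation: "closed_operator space_L2 translation_op"
proof -
  interpret I: weighted_translation M code T' T g by (rule inverse_translation)
  show ?thesis
    using I.closed_adjoint_translation by (simp add: I.adjoint_translation)
qed

text \<open>The operator and its adjoint share the domain of multiplication by \<open>g\<close>, so both products in the
definition of normality are multiplication by \<open>g\<^sup>2\<close> with its natural domain.\<close>

lemma domain_translation_op:
  assumes F: "F \<in> L2 M"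
  shows "(\<lambda>x. of_real (g x) * F (T x)) \<in> L2 M \<longleftrightarrow> (\<lambda>x. of_real (g x) * F x) \<in> L2 M"
proof -
  interpret I: weighted_translation M code T' T g by (rule inverse_translation)
  show ?thesis
    using L2_T[of "\<lambda>x. of_real (g x) * F x"] I.L2_T[of "\<lambda>x. of_real (g x) * F (T x)"]
    by (auto simp: g_T g_T' T_T')
qed

lemma normal_translation: "normal_operator space_L2 translation_op"
proof -
  interpret I: weighted_translation M code T' T g by (rule inverse_translation)
  have comp1: "translation_op O I.translation_op =
    {(code F, code (\<lambda>x. of_real (g x) * (of_real (g x) * F x))) | F. F \<in> L2 M \<and>
      (\<lambda>x. of_real (g x) * F x) \<in> L2 M \<and> (\<lambda>x. of_real (g x) * (of_real (g x) * F x)) \<in> L2 M}"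
    (is "_ = ?D")
  proof (intro equalityI subsetI)
    fix z assume "z \<in> translation_op O I.translation_op"
    then obtain F c where F: "F \<in> L2 M" "(\<lambda>x. of_real (g x) * F (T x)) \<in> L2 M"
      and z: "z = (code F, c)" "(code (\<lambda>x. of_real (g x) * F (T x)), c) \<in> I.translation_op"
      unfolding translation_op_def by blast
    from z(2) show "z \<in> ?D"
      using F unfolding z(1) I.translation_op_iff[OF F(2)]
      by (auto simp: g_T' T_T' domain_translation_op)
  next
    fix z assume "z \<in> ?D"
    then obtain F where F: "F \<in> L2 M" "(\<lambda>x. of_real (g x) * F x) \<in> L2 M"
      "(\<lambda>x. of_real (g x) * (of_real (g x) * F x)) \<in> L2 M"
      "z = (code F, code (\<lambda>x. of_real (g x) * (of_real (g x) * F x)))" by blast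
    then have "(\<lambda>x. of_real (g x) * F (T x)) \<in> L2 M" by (simp add: domain_translation_op)
    with F show "z \<in> translation_op O I.translation_op"
      by (auto intro!: relcompI[of _ "code (\<lambda>x. of_real (g x) * F (T x))"]
          simp: translation_op_iff I.translation_op_iff g_T' T_T')
  qed
  have comp2: "I.translation_op O translation_op = ?D"
  proof (intro equalityI subsetI)
    fix z assume "z \<in> I.translation_op O translation_op"
    then obtain F c where F: "F \<in> L2 M" "(\<lambda>x. of_real (g x) * F (T' x)) \<in> L2 M"
      and z: "z = (code F, c)" "(code (\<lambda>x. of_real (g x) * F (T' x)), c) \<in> translation_op"
      unfolding I.translation_op_def by blast
    from z(2) show "z \<in> ?D"
      using F unfolding z(1) translation_op_iff[OF F(2)]
      by (auto simp: g_T T'_T I.domain_translation_op)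
  next
    fix z assume "z \<in> ?D"
    then obtain F where F: "F \<in> L2 M" "(\<lambda>x. of_real (g x) * F x) \<in> L2 M"
      "(\<lambda>x. of_real (g x) * (of_real (g x) * F x)) \<in> L2 M"
      "z = (code F, code (\<lambda>x. of_real (g x) * (of_real (g x) * F x)))" by blast
    then have "(\<lambda>x. of_real (g x) * F (T' x)) \<in> L2 M" by (simp add: I.domain_translation_op)
    with F show "z \<in> I.translation_op O translation_op"
      by (auto intro!: relcompI[of _ "code (\<lambda>x. of_real (g x) * F (T' x))"]
          simp: translation_op_iff I.translation_op_iff g_T T'_T)
  qed
  show ?thesis
    unfolding normal_operator_def adjoint_translation comp1 comp2
    using linear_operator_translation densely_defined_translation closed_translation by blast
qed

end

section \<open>Countable disjoint sums of measures on the line\<close>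

lemma rational_rays_generate_borel:
  "(borel :: real measure) = sigma UNIV (range (\<lambda>q::rat. {..real_of_rat q}))"
proof (rule borel_eq_sigmaI1[OF borel_eq_atMost])
  fix A :: "real set" assume "A \<in> range (\<lambda>a. {..a})"
  then obtain a where a: "A = {..a}" by auto
  have "A = (\<Inter>q\<in>{q::rat. a < real_of_rat q}. {..real_of_rat q})"
  proof (intro equalityI subsetI)
    fix x assume x: "x \<in> (\<Inter>q\<in>{q::rat. a < real_of_rat q}. {..real_of_rat q})"
    have "x \<le> a"
    proof (rule ccontr)
      assume "\<not> x \<le> a"
      then obtain q where "a < real_of_rat q" "real_of_rat q < x"
        using of_rat_dense[of a x] by auto
      with x show False by auto
    qed
    then show "x \<in> A" by (simp add: a)
  qed (auto simp: a)
  also have "\<dots> \<in> sets (sigma UNIV (range (\<lambda>q::rat. {..real_of_rat q})))"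
  proof (rule sets.countable_INT'')
    obtain q :: rat where "a < real_of_rat q" using of_rat_dense[of a "a + 1"] by auto
    show "UNIV \<in> sets (sigma UNIV (range (\<lambda>q::rat. {..real_of_rat q})))"
      using sets.top[of "sigma UNIV (range (\<lambda>q::rat. {..real_of_rat q}))"] by (simp add: space_measure_of_conv)
  qed auto
  finally show "A \<in> sets (sigma UNIV (range (\<lambda>q::rat. {..real_of_rat q})))" .
qed auto

text \<open>The rational rays form an intersection-stable generator of the Borel sets, and the sets over which
the integral vanishes form a Dynkin system: the whole line belongs to it by letting the rays
grow.\<close>

lemma set_integral_zero_borel:
  fixes D :: "real \<Rightarrow> complex"
  assumes sets_N [measurable_cong]: "sets N = sets borel" and D: "integrable N D"
    and zero: "\<And>q::rat. (LINT s:{..real_of_rat q}|N. D s) = 0"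
    and A: "A \<in> sets borel"
  shows "(LINT s:A|N. D s) = 0"
proof -
  let ?G = "range (\<lambda>q::rat. {..real_of_rat q})"
  have G: "sets borel = sigma_sets UNIV ?G"
    by (subst rational_rays_generate_borel) simp
  have int: "set_integrable N B D" if "B \<in> sets borel" for B
    unfolding set_integrable_def
    by (rule integrable_mult_indicator) (use that sets_N D in auto)
  have total: "(LINT s|N. D s) = 0"
  proof -
    have "(\<lambda>n. \<integral>s. indicator {..real n} s *\<^sub>R D s \<partial>N) \<longlonglongrightarrow> (LINT s|N. D s)"
      by (rule filterlim_compose[OF tendsto_integral_at_top[OF sets_N D] filterlim_real_sequentially])
    moreover have "(\<integral>s. indicator {..real n} s *\<^sub>R D s \<partial>N) = 0" for n
      using zero[of "of_nat n"] by (simp add: set_lebesgue_integral_def)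
    ultimately show ?thesis by (simp add: LIMSEQ_const_iff)
  qed
  have "Int_stable ?G"
  proof (rule Int_stableI)
    fix a b assume "a \<in> ?G" "b \<in> ?G"
    then obtain p q where "a = {..real_of_rat p}" "b = {..real_of_rat q}" by auto
    then have "a \<inter> b = {..real_of_rat (min p q)}"
      by (auto simp: min_def of_rat_less_eq)
    then show "a \<inter> b \<in> ?G" by blast
  qed
  moreover have "?G \<subseteq> Pow UNIV" by simp
  moreover have "A \<in> sigma_sets UNIV ?G" using A by (simp add: G)
  ultimately show ?thesis
  proof (induction rule: sigma_sets_induct_disjoint)
    case (basic A)
    then show ?case using zero by auto
  next
    case empty
    show ?case by (simp add: set_lebesgue_integral_def)
  next
    case (compl A)
    have "(LINT s:UNIV|N. D s) = (LINT s:A|N. D s) + (LINT s:UNIV - A|N. D s)"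
      using compl(1) int
      by (subst set_integral_Un[symmetric]) (auto simp: G[symmetric])
    then show ?case using total compl by (simp add: set_lebesgue_integral_def)
  next
    case (union F)
    then have F: "F i \<in> sets borel" for i using union(2) by (auto simp: G)
    then have "(LINT s:(\<Union>i. F i)|N. D s) = (\<Sum>i. (LINT s:F i|N. D s))"
      using union(1) sets_N
      by (intro lebesgue_integral_countable_add int) (auto simp: disjoint_family_on_def)
    then show ?case using union by simp
  qed
qed

text \<open>Integrating \<open>D\<close> over the set where \<open>Re (c * D) > 0\<close> shows that this set is null. Letting \<open>c\<close>
run through the fourth roots of unity covers both signs of the real and imaginary parts.\<close>

lemma AE_zero_if_rational_rays_integrals_zero:
  fixes D :: "real \<Rightarrow> complex"
  assumes sets_N [measurable_cong]: "sets N = sets borel" and D: "integrable N D"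
    and zero: "\<And>q::rat. (LINT s:{..real_of_rat q}|N. D s) = 0"
  shows "AE s in N. D s = 0"
proof -
  have [measurable]: "D \<in> borel_measurable borel"
    using borel_measurable_integrable[OF D] measurable_cong_sets[OF sets_N refl] by blast
  have nonpos: "AE s in N. Re (c * D s) \<le> 0" for c
  proof -
    define A where "A = {s. 0 < Re (c * D s)}"
    have A: "A \<in> sets borel" unfolding A_def by measurable
    have intA: "integrable N (\<lambda>s. indicator A s *\<^sub>R D s)"
      by (rule integrable_mult_indicator) (use A sets_N D in auto)
    then have int: "integrable N (\<lambda>s. Re (c * (indicator A s *\<^sub>R D s)))"
      by (intro integrable_Re integrable_mult_right)
    have "(\<integral>s. Re (c * (indicator A s *\<^sub>R D s)) \<partial>N) = Re (c * (LINT s:A|N. D s))"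
      unfolding set_lebesgue_integral_def
      by (subst integral_Re[OF integrable_mult_right[OF intA]]) (simp only: integral_mult_right_zero)
    also have "\<dots> = 0"
      using set_integral_zero_borel[OF sets_N D zero A] by simp
    finally have "AE s in N. Re (c * (indicator A s *\<^sub>R D s)) = 0"
      by (subst (asm) integral_nonneg_eq_0_iff_AE[OF int]) (auto simp: A_def indicator_def)
    then show ?thesis
      by eventually_elim (auto simp: A_def indicator_def split: if_splits)
  qed
  from nonpos[of 1] nonpos[of "-1"] nonpos[of \<i>] nonpos[of "-\<i>"] show ?thesis
    by eventually_elim (auto simp: complex_eq_iff)
qed

lemma (in finite_measure) L2_integrable:
  assumes "F \<in> L2 M"
  shows "integrable M F"
proof (rule Bochner_Integration.integrable_bound)
  show "integrable M (\<lambda>x. 1 + (cmod (F x))\<^sup>2)"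
    using L2_integrable_square[OF assms] by simp
  show "AE x in M. norm (F x) \<le> norm (1 + (cmod (F x))\<^sup>2)"
  proof (rule AE_I2)
    fix x
    have "2 * cmod (F x) \<le> (cmod (F x))\<^sup>2 + 1"
      using sum_squares_bound[of "cmod (F x)" 1] by simp
    moreover have "0 \<le> cmod (F x)" by simp
    ultimately have "cmod (F x) \<le> 1 + (cmod (F x))\<^sup>2" by linarith
    then show "norm (F x) \<le> norm (1 + (cmod (F x))\<^sup>2)" by simp
  qed
qed (use assms in measurable)

text \<open>A countable family of finite measures on the line is glued to one measure on pairs; \<open>\<nu> p\<close> is
placed on the line over the point \<open>p\<close> of the base. Finiteness of the fibres makes square
integrable functions integrable on each fibre, so that the codes below are defined by
convergent integrals.\<close>

locale fibre_measures =
  fixes \<nu> :: "'p::countable \<Rightarrow> real measure"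
  assumes sets_fibre [simp, measurable_cong]: "\<And>p. sets (\<nu> p) = sets borel"
    and finite_fibre: "\<And>p. finite_measure (\<nu> p)"
begin

definition total :: "('p \<times> real) measure" where
  "total = measure_of UNIV (sets (count_space UNIV \<Otimes>\<^sub>M borel))
     (\<lambda>A. \<integral>\<^sup>+p. emeasure (\<nu> p) (Pair p -` A) \<partial>count_space UNIV)"

lemma sets_total [simp, measurable_cong]: "sets total = sets (count_space UNIV \<Otimes>\<^sub>M borel)"
  using sets.sets_measure_of_eq[of "count_space (UNIV::'p set) \<Otimes>\<^sub>M (borel::real measure)"]
  by (simp add: total_def space_pair_measure)

lemma space_total [simp]: "space total = UNIV"
  by (simp add: total_def space_measure_of_conv)

lemma measurable_total:
  assumes "\<And>p. (\<lambda>s. f (p, s)) \<in> measurable borel N"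
  shows "f \<in> measurable total N"
proof -
  have "f \<in> measurable (count_space UNIV \<Otimes>\<^sub>M borel) N"
    by (rule measurable_pair_measure_countable1) (use assms in auto)
  then show ?thesis
    using measurable_cong_sets[OF sets_total refl, of N] by blast
qed

lemma measurable_fibre:
  assumes "f \<in> measurable total N"
  shows "(\<lambda>s. f (p, s)) \<in> measurable (\<nu> p) N"
proof -
  have "f \<in> measurable (count_space UNIV \<Otimes>\<^sub>M borel) N"
    using assms measurable_cong_sets[OF sets_total refl, of N] by blast
  then have "(\<lambda>s. f (p, s)) \<in> measurable borel N" by measurable
  then show ?thesis using measurable_cong_sets[OF sets_fibre refl, of p N] by blast
qed

lemma emeasure_total:
  assumes "A \<in> sets total"
  shows "emeasure total A = (\<integral>\<^sup>+p. emeasure (\<nu> p) (Pair p -` A) \<partial>count_space UNIV)"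
proof (rule emeasure_measure_of[OF total_def])
  show "sets (count_space UNIV \<Otimes>\<^sub>M borel) \<subseteq> Pow (UNIV :: ('p \<times> real) set)" by simp
  show "A \<in> sets total" by fact
  show "positive (sets total) (\<lambda>A. \<integral>\<^sup>+p. emeasure (\<nu> p) (Pair p -` A) \<partial>count_space UNIV)"
    by (simp add: positive_def)
  show "countably_additive (sets total) (\<lambda>A. \<integral>\<^sup>+p. emeasure (\<nu> p) (Pair p -` A) \<partial>count_space UNIV)"
  proof (rule countably_additiveI)
    fix A :: "nat \<Rightarrow> ('p \<times> real) set"
    assume A: "range A \<subseteq> sets total" "disjoint_family A"
    have "(\<Sum>i. \<integral>\<^sup>+p. emeasure (\<nu> p) (Pair p -` A i) \<partial>count_space UNIV)
      = (\<integral>\<^sup>+p. (\<Sum>i. emeasure (\<nu> p) (Pair p -` A i)) \<partial>count_space UNIV)"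
      by (rule nn_integral_suminf[symmetric]) simp
    also have "\<dots> = (\<integral>\<^sup>+p. emeasure (\<nu> p) (Pair p -` (\<Union>i. A i)) \<partial>count_space UNIV)"
    proof (rule nn_integral_cong)
      fix p
      have "range (\<lambda>i. Pair p -` A i) \<subseteq> sets (\<nu> p)"
        using A(1) by (auto intro!: sets_Pair1[of _ "count_space UNIV"])
      moreover have "disjoint_family (\<lambda>i. Pair p -` A i)"
        using A(2) by (auto simp: disjoint_family_on_def)
      ultimately show "(\<Sum>i. emeasure (\<nu> p) (Pair p -` A i)) = emeasure (\<nu> p) (Pair p -` (\<Union>i. A i))"
        by (simp add: suminf_emeasure vimage_UN)
    qed
    finally show "(\<Sum>i. \<integral>\<^sup>+p. emeasure (\<nu> p) (Pair p -` A i) \<partial>count_space UNIV)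
      = (\<integral>\<^sup>+p. emeasure (\<nu> p) (Pair p -` (\<Union>i. A i)) \<partial>count_space UNIV)" .
  qed
qed

lemma nn_integral_total:
  assumes "f \<in> borel_measurable total"
  shows "(\<integral>\<^sup>+x. f x \<partial>total) = (\<integral>\<^sup>+p. \<integral>\<^sup>+s. f (p, s) \<partial>\<nu> p \<partial>count_space UNIV)"
  using assms
proof (induction rule: borel_measurable_induct)
  case (cong f g)
  then have "f = g" by auto
  with cong show ?case by simp
next
  case (set A)
  have "(\<integral>\<^sup>+s. indicator A (p, s) \<partial>\<nu> p) = emeasure (\<nu> p) (Pair p -` A)" for p
  proof -
    have "Pair p -` A \<in> sets (\<nu> p)"
      using set by (auto intro!: sets_Pair1[of _ "count_space UNIV"])
    then have "emeasure (\<nu> p) (Pair p -` A) = (\<integral>\<^sup>+s. indicator (Pair p -` A) s \<partial>\<nu> p)" by simp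
    also have "\<dots> = (\<integral>\<^sup>+s. indicator A (p, s) \<partial>\<nu> p)"
      by (rule nn_integral_cong) (simp add: indicator_def)
    finally show ?thesis by simp
  qed
  with set show ?case by (simp add: emeasure_total del: sets_total)
next
  case (mult u c)
  then show ?case
    using measurable_fibre[OF mult.hyps(2)] by (simp add: nn_integral_cmult)
next
  case (add u v)
  then show ?case
    using measurable_fibre[OF add.hyps(1)] measurable_fibre[OF add.hyps(3)] by (simp add: nn_integral_add)
next
  case (seq U)
  have inc: "incseq (\<lambda>i s. U i (p, s))" for p
    using seq.hyps(3) by (auto simp: incseq_def le_fun_def)
  have "(\<integral>\<^sup>+x. (SUP i. U i) x \<partial>total) = (SUP i. \<integral>\<^sup>+x. U i x \<partial>total)"
    unfolding SUP_apply by (rule nn_integral_monotone_convergence_SUP) (use seq.hyps in auto)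
  also have "\<dots> = (SUP i. \<integral>\<^sup>+p. \<integral>\<^sup>+s. U i (p, s) \<partial>\<nu> p \<partial>count_space UNIV)"
    using seq.IH by simp
  also have "\<dots> = (\<integral>\<^sup>+p. (SUP i. \<integral>\<^sup>+s. U i (p, s) \<partial>\<nu> p) \<partial>count_space UNIV)"
  proof (rule nn_integral_monotone_convergence_SUP[symmetric])
    show "incseq (\<lambda>i p. \<integral>\<^sup>+s. U i (p, s) \<partial>\<nu> p)"
      using inc by (auto simp: incseq_def le_fun_def intro!: nn_integral_mono)
  qed simp
  also have "\<dots> = (\<integral>\<^sup>+p. \<integral>\<^sup>+s. (SUP i. U i) (p, s) \<partial>\<nu> p \<partial>count_space UNIV)"
    unfolding SUP_apply
    by (intro nn_integral_cong nn_integral_monotone_convergence_SUP[symmetric] inc measurable_fibre seq.hyps)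
  finally show ?case .
qed

lemma AE_total_imp_fibre:
  assumes "AE x in total. P x"
  shows "AE s in \<nu> p. P (p, s)"
proof -
  obtain B where B: "{x\<in>space total. \<not> P x} \<subseteq> B" "emeasure total B = 0" "B \<in> sets total"
    using assms by (rule AE_E)
  have "emeasure (\<nu> p) (Pair p -` B) \<le> (\<integral>\<^sup>+p. emeasure (\<nu> p) (Pair p -` B) \<partial>count_space UNIV)"
    by (rule nn_integral_ge_point) simp
  also have "\<dots> = 0"
    using B emeasure_total by simp
  finally have "emeasure (\<nu> p) (Pair p -` B) = 0" by simp
  moreover have "Pair p -` B \<in> sets (\<nu> p)"
    using B(3) by (auto intro!: sets_Pair1[of _ "count_space UNIV"])
  ultimately show ?thesis
    using B(1) by (intro AE_I[of _ _ "Pair p -` B"]) auto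
qed

lemma AE_totalI:
  assumes [measurable]: "Measurable.pred total P"
    and P: "\<And>p. AE s in \<nu> p. P (p, s)"
  shows "AE x in total. P x"
proof -
  have meas: "{x\<in>space total. \<not> P x} \<in> sets total" by measurable
  have "emeasure total {x\<in>space total. \<not> P x}
    = (\<integral>\<^sup>+p. emeasure (\<nu> p) {s\<in>space (\<nu> p). \<not> P (p, s)} \<partial>count_space UNIV)"
    unfolding emeasure_total[OF meas] by (auto intro!: nn_integral_cong arg_cong2[where f=emeasure]
        simp: vimage_def sets_eq_imp_space_eq[OF sets_fibre] simp del: sets_total)
  also have "\<dots> = 0"
    using P measurable_fibre[OF assms(1)]
    by (simp add: nn_integral_0_iff_AE AE_iff_measurable[OF _ refl])
  finally show ?thesis by (simp only: AE_iff_measurable[OF meas refl])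
qed

lemma L2_fibre:
  assumes "F \<in> L2 total"
  shows "(\<lambda>s. F (p, s)) \<in> L2 (\<nu> p)"
proof -
  note [measurable] = L2_measurable[OF assms]
  have "(\<integral>\<^sup>+s. ennreal ((cmod (F (p, s)))\<^sup>2) \<partial>\<nu> p)
    \<le> (\<integral>\<^sup>+p. \<integral>\<^sup>+s. ennreal ((cmod (F (p, s)))\<^sup>2) \<partial>\<nu> p \<partial>count_space UNIV)"
    by (rule nn_integral_ge_point) simp
  also have "\<dots> = (\<integral>\<^sup>+x. ennreal ((cmod (F x))\<^sup>2) \<partial>total)"
    by (rule nn_integral_total[symmetric]) measurable
  also have "\<dots> < \<infinity>" using assms by (simp add: L2_iff_nn_integral)
  finally show ?thesis
    using measurable_fibre[OF L2_measurable[OF assms]] by (simp add: L2_iff_nn_integral)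
qed

text \<open>There are countably many pairs of a base point and a rational ray, which are enumerated by the trunk
vertices; nothing is stored on the branches.\<close>

fun ray_code :: "('p \<times> real \<Rightarrow> complex) \<Rightarrow> vertex \<Rightarrow> complex" where
  "ray_code F (Trunk k) =
     (let (p, q) = from_nat k :: 'p \<times> rat in LINT s:{..real_of_rat q}|\<nu> p. F (p, s))"
| "ray_code F (Branch i j) = 0"

lemma coded_L2_ray_code: "coded_L2 total ray_code"
proof
  fix F G assume F: "F \<in> L2 total" and G: "G \<in> L2 total"
  show "ray_code F = ray_code G \<longleftrightarrow> (AE x in total. F x = G x)"
  proof
    assume ae: "AE x in total. F x = G x"
    have "(LINT s:{..a}|\<nu> p. F (p, s)) = (LINT s:{..a}|\<nu> p. G (p, s))" for a p
      unfolding set_lebesgue_integral_def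
      using AE_total_imp_fibre[OF ae, of p] measurable_fibre[OF L2_measurable[OF F]]
        measurable_fibre[OF L2_measurable[OF G]]
      by (intro integral_cong_AE) auto
    then have "ray_code F v = ray_code G v" for v
      by (cases v) (auto split: prod.split)
    then show "ray_code F = ray_code G" by (rule ext)
  next
    assume eq: "ray_code F = ray_code G"
    note [measurable] = L2_measurable[OF F] L2_measurable[OF G]
    show "AE x in total. F x = G x"
    proof (rule AE_totalI)
      fix p
      have intF: "integrable (\<nu> p) (\<lambda>s. F (p, s))" and intG: "integrable (\<nu> p) (\<lambda>s. G (p, s))"
        using finite_measure.L2_integrable[OF finite_fibre] L2_fibre F G by blast+
      have "(LINT s:{..real_of_rat q}|\<nu> p. F (p, s) - G (p, s)) = 0" for q
      proof -
        have "ray_code F (Trunk (to_nat (p, q))) = ray_code G (Trunk (to_nat (p, q)))"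
          by (simp add: eq)
        then have "(LINT s:{..real_of_rat q}|\<nu> p. F (p, s)) = (LINT s:{..real_of_rat q}|\<nu> p. G (p, s))"
          by simp
        moreover have "set_integrable (\<nu> p) {..real_of_rat q} (\<lambda>s. F (p, s))"
          "set_integrable (\<nu> p) {..real_of_rat q} (\<lambda>s. G (p, s))"
          unfolding set_integrable_def using intF intG by (auto intro!: integrable_mult_indicator)
        ultimately show ?thesis by simp
      qed
      then have "AE s in \<nu> p. F (p, s) - G (p, s) = 0"
        using intF intG by (intro AE_zero_if_rational_rays_integrals_zero) auto
      then show "AE s in \<nu> p. F (p, s) = G (p, s)" by simp
    qed measurable
  qed
qed

text \<open>A permutation of the base that preserves the fibre measures preserves the total measure; this gives
the translations between the levels.\<close>

lemma distr_total_base_bij: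
  assumes \<tau>: "bij \<tau>" and inv: "\<And>p. \<nu> (\<tau> p) = \<nu> p"
  shows "(\<lambda>(p, s). (\<tau> p, s)) \<in> measurable total total"
    and "distr total total (\<lambda>(p, s). (\<tau> p, s)) = total"
proof -
  show T: "(\<lambda>(p, s). (\<tau> p, s)) \<in> measurable total total"
    using measurable_cong_sets[OF refl sets_total, of total]
    by (auto intro!: measurable_total)
  show "distr total total (\<lambda>(p, s). (\<tau> p, s)) = total"
  proof (rule measure_eqI)
    fix A assume "A \<in> sets (distr total total (\<lambda>(p, s). (\<tau> p, s)))"
    then have A: "A \<in> sets total" by simp
    have "emeasure (distr total total (\<lambda>(p, s). (\<tau> p, s))) A
      = emeasure total ((\<lambda>(p, s). (\<tau> p, s)) -` A)"
      by (simp add: emeasure_distr[OF T A])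
    also have "\<dots> = (\<integral>\<^sup>+p. emeasure (\<nu> (\<tau> p)) (Pair (\<tau> p) -` A) \<partial>count_space UNIV)"
      using measurable_sets[OF T A] by (subst emeasure_total) (auto simp: inv vimage_def simp del: sets_total)
    also have "\<dots> = (\<integral>\<^sup>+p. emeasure (\<nu> p) (Pair p -` A) \<partial>count_space UNIV)"
      by (rule nn_integral_bij_count_space[OF \<tau>])
    also have "\<dots> = emeasure total A" using emeasure_total[OF A] by simp
    finally show "emeasure (distr total total (\<lambda>(p, s). (\<tau> p, s))) A = emeasure total A" .
  qed simp
qed

end

section \<open>Square summable families and weighted shifts\<close>

lemma carrier_ell2_iff:
  "f \<in> carrier (ell2 V) \<longleftrightarrow> (\<forall>v. v \<notin> V \<longrightarrow> f v = 0) \<and> f \<in> L2 (count_space UNIV)"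
proof -
  have "(\<lambda>v. (cmod (f v))\<^sup>2) summable_on V \<longleftrightarrow> f \<in> L2 (count_space UNIV)"
    if "\<And>v. v \<notin> V \<Longrightarrow> f v = 0"
  proof -
    have "(\<lambda>v. (cmod (f v))\<^sup>2) summable_on V \<longleftrightarrow> (\<lambda>v. (cmod (f v))\<^sup>2) summable_on UNIV"
      by (rule summable_on_cong_neutral) (use that in auto)
    also have "\<dots> \<longleftrightarrow> integrable (count_space UNIV) (\<lambda>v. (cmod (f v))\<^sup>2)"
      using abs_summable_equivalent[of "\<lambda>v. (cmod (f v))\<^sup>2" UNIV] by (simp add: abs_summable_on_def)
    finally show ?thesis by (simp add: L2_def)
  qed
  then show ?thesis by (auto simp: ell2_def)
qed

lemma inner_ell2:
  assumes f: "f \<in> carrier (ell2 V)" and g: "g \<in> carrier (ell2 V)"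
  shows "inner_prod (ell2 V) f g = (\<integral>v. f v * cnj (g v) \<partial>count_space UNIV)"
proof -
  have "(\<Sum>\<^sub>\<infinity>v\<in>V. f v * cnj (g v)) = (\<Sum>\<^sub>\<infinity>v. f v * cnj (g v))"
    by (rule infsum_cong_neutral) (use f in \<open>auto simp: carrier_ell2_iff\<close>)
  also have "\<dots> = (\<Sum>\<^sub>av. f v * cnj (g v))"
    by (rule infsetsum_infsum[symmetric])
      (use L2_mult_integrable f g in \<open>auto simp: carrier_ell2_iff abs_summable_on_def\<close>)
  finally show ?thesis by (simp add: ell2_def infsetsum_def)
qed

lemma ell2_simps:
  "\<zero>\<^bsub>ell2 V\<^esub> = (\<lambda>v. 0)"
  "f \<oplus>\<^bsub>ell2 V\<^esub> g = (\<lambda>v. f v + g v)"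
  "c \<odot>\<^bsub>ell2 V\<^esub> f = (\<lambda>v. c * f v)"
  by (simp_all add: ell2_def)

lemma ell2_closed:
  "(\<lambda>v. 0) \<in> carrier (ell2 V)"
  "f \<in> carrier (ell2 V) \<Longrightarrow> g \<in> carrier (ell2 V) \<Longrightarrow> (\<lambda>v. f v + g v) \<in> carrier (ell2 V)"
  "f \<in> carrier (ell2 V) \<Longrightarrow> (\<lambda>v. c * f v) \<in> carrier (ell2 V)"
  by (auto simp: carrier_ell2_iff L2_add L2_scale)

lemma ell2_minus:
  assumes f: "f \<in> carrier (ell2 V)" and g: "g \<in> carrier (ell2 V)"
  shows "f \<ominus>\<^bsub>ell2 V\<^esub> g = (\<lambda>v. f v - g v)"
proof -
  have g': "(\<lambda>v. - g v) \<in> carrier (ell2 V)" using ell2_closed(3)[OF g, of "- 1"] by simp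
  have "\<ominus>\<^bsub>ell2 V\<^esub> g = (\<lambda>v. - g v)"
    unfolding a_inv_def m_inv_def
  proof (rule the_equality)
    fix y assume y: "y \<in> carrier (add_monoid (ell2 V)) \<and>
      g \<otimes>\<^bsub>add_monoid (ell2 V)\<^esub> y = \<one>\<^bsub>add_monoid (ell2 V)\<^esub> \<and>
      y \<otimes>\<^bsub>add_monoid (ell2 V)\<^esub> g = \<one>\<^bsub>add_monoid (ell2 V)\<^esub>"
    then have "y v + g v = 0" for v by (auto simp: ell2_simps fun_eq_iff)
    then show "y = (\<lambda>v. - g v)" by (auto simp: fun_eq_iff add_eq_0_iff2)
  qed (use g' in \<open>auto simp: ell2_simps\<close>)
  then show ?thesis by (simp add: a_minus_def ell2_simps)
qed

lemma hdist_ell2: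
  assumes f: "f \<in> carrier (ell2 V)" and g: "g \<in> carrier (ell2 V)"
  shows "hdist (ell2 V) f g = sqrt (\<Sum>\<^sub>\<infinity>v\<in>V. (cmod (f v - g v))\<^sup>2)"
proof -
  have "inner_prod (ell2 V) (\<lambda>v. f v - g v) (\<lambda>v. f v - g v)
    = (\<Sum>\<^sub>\<infinity>v\<in>V. complex_of_real ((cmod (f v - g v))\<^sup>2))"
    unfolding complex_norm_square by (simp add: ell2_def)
  also have "\<dots> = complex_of_real (\<Sum>\<^sub>\<infinity>v\<in>V. (cmod (f v - g v))\<^sup>2)"
  proof (rule infsumI[OF has_sum_of_real[OF has_sum_infsum]])
    have "(\<lambda>v. f v - g v) \<in> carrier (ell2 V)"
      using f g by (auto simp: carrier_ell2_iff L2_diff)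
    then show "(\<lambda>v. (cmod (f v - g v))\<^sup>2) summable_on V" by (simp add: ell2_def)
  qed
  finally show ?thesis by (simp add: hdist_def ell2_minus f g hnorm_def)
qed

lemma finite_support_ell2:
  assumes "finite {v. f v \<noteq> 0}" "\<And>v. f v \<noteq> 0 \<Longrightarrow> v \<in> V"
  shows "f \<in> carrier (ell2 V)"
proof -
  have "(\<lambda>v. (cmod (f v))\<^sup>2) summable_on {v. f v \<noteq> 0}" using assms(1) by simp
  then have "(\<lambda>v. (cmod (f v))\<^sup>2) summable_on V"
    by (subst summable_on_cong_neutral[of "{v. f v \<noteq> 0}"]) (use assms(2) in auto)
  then show ?thesis using assms(2) by (auto simp: ell2_def)
qed

lemma linear_operator_weighted_shift: "linear_operator (ell2 V) (weighted_shift V E lam)"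
proof -
  have add: "shift_map V E lam (\<lambda>v. f v + g v) = (\<lambda>v. shift_map V E lam f v + shift_map V E lam g v)" for f g
    by (auto simp: shift_map_def fun_eq_iff distrib_left)
  have scale: "shift_map V E lam (\<lambda>v. c * f v) = (\<lambda>v. c * shift_map V E lam f v)" for f c
    by (auto simp: shift_map_def fun_eq_iff)
  have zero: "shift_map V E lam (\<lambda>v. 0) = (\<lambda>v. 0)"
    by (auto simp: shift_map_def fun_eq_iff)
  show ?thesis
    unfolding linear_operator_def
    by (intro conjI)
      (auto simp: weighted_shift_def single_valued_def ell2_simps ell2_closed add scale zero)
qed

text \<open>The domain is a subspace, so with the basis vectors it contains all vectors of finite
support.\<close>

lemma densely_defined_weighted_shift:
  assumes basis: "\<And>v. v \<in> V \<Longrightarrow> indicator {v} \<in> Domain (weighted_shift V E lam)"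
  shows "densely_defined (ell2 V) (weighted_shift V E lam)"
  unfolding densely_defined_def
proof (intro ballI allI impI)
  fix f :: "'a \<Rightarrow> complex" and \<epsilon> :: real
  assume f: "f \<in> carrier (ell2 V)" and \<epsilon>: "0 < \<epsilon>"
  let ?S = "weighted_shift V E lam"
  have lin: "linear_operator (ell2 V) ?S" by (rule linear_operator_weighted_shift)
  have Dom_sub: "Domain ?S \<subseteq> carrier (ell2 V)"
    by (auto simp: weighted_shift_def)
  have sq: "(\<lambda>v. (cmod (f v))\<^sup>2) summable_on V" using f by (simp add: ell2_def)
  have "(sum (\<lambda>v. (cmod (f v))\<^sup>2) \<longlongrightarrow> (\<Sum>\<^sub>\<infinity>v\<in>V. (cmod (f v))\<^sup>2)) (finite_subsets_at_top V)"
    using has_sum_infsum[OF sq] by (simp add: has_sum_def)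
  then have "\<forall>\<^sub>F F in finite_subsets_at_top V.
      (\<Sum>\<^sub>\<infinity>v\<in>V. (cmod (f v))\<^sup>2) - \<epsilon>\<^sup>2 < (\<Sum>v\<in>F. (cmod (f v))\<^sup>2)"
    by (rule order_tendstoD) (use \<epsilon> in simp)
  then obtain F where F: "finite F" "F \<subseteq> V"
      "(\<Sum>\<^sub>\<infinity>v\<in>V. (cmod (f v))\<^sup>2) - \<epsilon>\<^sup>2 < (\<Sum>v\<in>F. (cmod (f v))\<^sup>2)"
    unfolding eventually_finite_subsets_at_top by blast
  define h where "h = (\<lambda>v. if v \<in> F then f v else 0)"
  have "(\<lambda>v. if v \<in> F then f v else 0) \<in> Domain ?S" if "finite F" "F \<subseteq> V" for F
    using that
  proof (induction F)
    case empty
    then show ?case using lin by (auto simp: linear_operator_def ell2_simps)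
  next
    case (insert a F)
    from basis[of a] insert obtain x where x: "(indicator {a}, x) \<in> ?S" by auto
    then have "(f a \<odot>\<^bsub>ell2 V\<^esub> indicator {a}, f a \<odot>\<^bsub>ell2 V\<^esub> x) \<in> ?S"
      using lin by (auto simp: linear_operator_def)
    moreover obtain y where "(\<lambda>v. if v \<in> F then f v else 0, y) \<in> ?S"
      using insert by auto
    ultimately have "((\<lambda>v. if v \<in> F then f v else 0) \<oplus>\<^bsub>ell2 V\<^esub> (f a \<odot>\<^bsub>ell2 V\<^esub> indicator {a}),
        y \<oplus>\<^bsub>ell2 V\<^esub> (f a \<odot>\<^bsub>ell2 V\<^esub> x)) \<in> ?S"
      using lin unfolding linear_operator_def by fast
    moreover have "(\<lambda>v. if v \<in> F then f v else 0) \<oplus>\<^bsub>ell2 V\<^esub> (f a \<odot>\<^bsub>ell2 V\<^esub> indicator {a})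
      = (\<lambda>v. if v \<in> insert a F then f v else 0)"
      using insert by (auto simp: ell2_simps fun_eq_iff indicator_def)
    ultimately show ?case by auto
  qed
  from this[OF F(1,2)] have h: "h \<in> Domain ?S" by (simp add: h_def)
  have "(\<Sum>\<^sub>\<infinity>v\<in>V. (cmod (h v - f v))\<^sup>2) = (\<Sum>\<^sub>\<infinity>v\<in>V - F. (cmod (f v))\<^sup>2)"
    by (rule infsum_cong_neutral) (auto simp: h_def)
  also have "\<dots> = (\<Sum>\<^sub>\<infinity>v\<in>V. (cmod (f v))\<^sup>2) - (\<Sum>v\<in>F. (cmod (f v))\<^sup>2)"
    using F sq by (subst infsum_Diff) auto
  also have "\<dots> < \<epsilon>\<^sup>2" using F(3) by simp
  finally have "hdist (ell2 V) h f < \<epsilon>"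
    using h Dom_sub f \<epsilon> by (subst hdist_ell2) (auto intro!: real_less_lsqrt infsum_nonneg)
  with h show "\<exists>y\<in>Domain ?S. hdist (ell2 V) y f < \<epsilon>" by blast
qed

lemma Trunk_in_tree: "Trunk k \<in> tree_V \<eta> \<kappa> \<longleftrightarrow> enat k \<le> \<kappa>"
  by (cases k) (auto simp: tree_V_def J_def zero_enat_def[symmetric])

lemma Branch_in_tree: "Branch i j \<in> tree_V \<eta> \<kappa> \<longleftrightarrow> i \<in> J \<eta> \<and> 1 \<le> j"
  by (auto simp: tree_V_def)

lemma edge_to_Trunk: "(u, Trunk k) \<in> tree_E \<eta> \<kappa> \<longleftrightarrow> u = Trunk (Suc k) \<and> enat (Suc k) \<le> \<kappa>"
  by (auto simp: tree_E_def J_def intro: exI[of _ "Suc k"])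

lemma edge_to_Branch:
  "(u, Branch i j) \<in> tree_E \<eta> \<kappa> \<longleftrightarrow>
    i \<in> J \<eta> \<and> (j = 1 \<and> u = Trunk 0 \<or> 2 \<le> j \<and> u = Branch i (j - 1))"
  by (auto simp: tree_E_def intro: exI[of _ "j - 1"])

lemma Trunk_nonroot: "Trunk k \<in> nonroot (tree_V \<eta> \<kappa>) (tree_E \<eta> \<kappa>) \<longleftrightarrow> enat (Suc k) \<le> \<kappa>"
  by (auto simp: nonroot_def Trunk_in_tree edge_to_Trunk intro: order_trans[of _ "enat (Suc k)"])

lemma Branch_nonroot: "Branch i j \<in> nonroot (tree_V \<eta> \<kappa>) (tree_E \<eta> \<kappa>) \<longleftrightarrow> i \<in> J \<eta> \<and> 1 \<le> j"
  by (cases "j = 1") (auto simp: nonroot_def Branch_in_tree edge_to_Branch)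

lemma par_Trunk: "enat (Suc k) \<le> \<kappa> \<Longrightarrow> par (tree_E \<eta> \<kappa>) (Trunk k) = Trunk (Suc k)"
  by (simp add: par_def edge_to_Trunk)

lemma par_Branch:
  "i \<in> J \<eta> \<Longrightarrow> 1 \<le> j \<Longrightarrow>
    par (tree_E \<eta> \<kappa>) (Branch i j) = (if j = 1 then Trunk 0 else Branch i (j - 1))"
  by (auto simp: par_def edge_to_Branch)

lemmas shift_map_tree_simps = shift_map_def Trunk_nonroot Branch_nonroot par_Trunk par_Branch

text \<open>Every vertex other than \<open>0\<close> has at most one child, so the image of its basis vector is supported
in a single point \<open>c\<close>.\<close>

lemma basis_in_domain_tree_shift:
  assumes e0: "indicator {Trunk 0} \<in> C_infinity_domain (ell2 (tree_V \<eta> \<kappa>)) (tree_shift \<eta> \<kappa> lam)"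
    and v: "v \<in> tree_V \<eta> \<kappa>"
  shows "indicator {v} \<in> Domain (tree_shift \<eta> \<kappa> lam)"
proof (cases "v = Trunk 0")
  case True
  have "indicator {Trunk 0} \<in> Domain (tree_shift \<eta> \<kappa> lam ^^ 1)"
    using e0 unfolding C_infinity_domain_def by blast
  then show ?thesis using True by simp
next
  case False
  define c where "c = (case v of Trunk k \<Rightarrow> Trunk (k - 1) | Branch i j \<Rightarrow> Branch i (Suc j))"
  have child: "w = c" if "shift_map (tree_V \<eta> \<kappa>) (tree_E \<eta> \<kappa>) lam (indicator {v}) w \<noteq> 0" for w
    using that v False
    by (cases w; cases v) (auto simp: shift_map_tree_simps c_def Branch_in_tree indicator_def split: if_splits)
  have "shift_map (tree_V \<eta> \<kappa>) (tree_E \<eta> \<kappa>) lam (indicator {v}) \<in> carrier (ell2 (tree_V \<eta> \<kappa>))"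
  proof (rule finite_support_ell2)
    show "finite {w. shift_map (tree_V \<eta> \<kappa>) (tree_E \<eta> \<kappa>) lam (indicator {v}) w \<noteq> 0}"
      using child by (auto intro: finite_subset[of _ "{c}"])
  qed (auto simp: shift_map_def nonroot_def split: if_splits)
  moreover have "indicator {v} \<in> carrier (ell2 (tree_V \<eta> \<kappa>))"
    by (rule finite_support_ell2) (use v in \<open>auto simp: indicator_def\<close>)
  ultimately show ?thesis by (auto simp: weighted_shift_def)
qed

section \<open>The normal extension of the tree shift\<close>

instance vertex :: countable
  by countable_datatype

definition point_mass_0 :: "real measure" where
  "point_mass_0 = distr (count_space {()}) borel (\<lambda>_. 0)"

lemma sets_point_mass_0 [simp, measurable_cong]: "sets point_mass_0 = sets borel"
  by (simp add: point_mass_0_def)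

lemma nn_integral_point_mass_0:
  "f \<in> borel_measurable borel \<Longrightarrow> (\<integral>\<^sup>+s. f s \<partial>point_mass_0) = f 0"
  by (simp add: point_mass_0_def nn_integral_distr nn_integral_count_space_finite)

lemma AE_point_mass_0: "AE s in point_mass_0. s = 0"
  unfolding point_mass_0_def by (subst AE_distr_iff) auto

lemma emeasure_point_mass_0 [simp]: "emeasure point_mass_0 (space point_mass_0) = 1"
  by (simp add: point_mass_0_def emeasure_distr)

lemma finite_point_mass_0: "finite_measure point_mass_0"
  by (rule finite_measureI) simp

lemma nn_integral_count_space_single:
  "(\<integral>\<^sup>+a. (if a = b then c else 0) \<partial>count_space UNIV) = (c :: ennreal)"
  by (subst nn_integral_count_space'[of "{b}"]) auto

lemma sqrt_power_square: "0 \<le> s \<Longrightarrow> (sqrt s ^ j)\<^sup>2 = s ^ j"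
  by (simp add: real_sqrt_power[symmetric])

text \<open>The squared norm that the image of the basis vector at \<open>-k\<close> has before any correction at the
root. The integrand is infinite at \<open>0\<close>, so that, for nonzero weights, a finite value excludes
atoms there.\<close>

definition trunk_moment :: "enat \<Rightarrow> (vertex \<Rightarrow> complex) \<Rightarrow> (nat \<Rightarrow> real measure) \<Rightarrow> nat \<Rightarrow> ennreal" where
  "trunk_moment \<eta> lam m k =
     (\<integral>\<^sup>+i. (if i \<in> J \<eta> then ennreal ((cmod (lam (Branch i 1) * (\<Prod>j<k. lam (Trunk j))))\<^sup>2) *
        (\<integral>\<^sup>+s. 1 / ennreal (s ^ (k + 1)) \<partial>m i) else 0) \<partial>count_space UNIV)"

text \<open>The four sets of conditions enter the construction only through the values of \<open>trunk_moment\<close>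
assumed here. The measures are taken on the whole line, concentrated on the positive half.\<close>

locale tree_moments =
  fixes \<eta> \<kappa> :: enat and lam :: "vertex \<Rightarrow> complex" and m :: "nat \<Rightarrow> real measure"
  assumes sets_m: "\<And>i. i \<in> J \<eta> \<Longrightarrow> sets (m i) = sets borel"
    and emeasure_m: "\<And>i. i \<in> J \<eta> \<Longrightarrow> emeasure (m i) UNIV = 1"
    and AE_m_pos: "\<And>i. i \<in> J \<eta> \<Longrightarrow> AE s in m i. 0 < s"
    and lam_nonzero: "\<And>v. v \<in> nonroot (tree_V \<eta> \<kappa>) (tree_E \<eta> \<kappa>) \<Longrightarrow> lam v \<noteq> 0"
    and branch_moments: "\<And>n i. 1 \<le> n \<Longrightarrow> i \<in> J \<eta> \<Longrightarrow>
      (\<integral>\<^sup>+s. ennreal (s ^ n) \<partial>m i) = ennreal ((cmod (\<Prod>j=2..n+1. lam (Branch i j)))\<^sup>2)"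
    and trunk_moment_eq_1: "\<And>k. enat k < \<kappa> \<Longrightarrow> trunk_moment \<eta> lam m k = 1"
    and trunk_moment_le_1: "\<And>k. enat k = \<kappa> \<Longrightarrow> trunk_moment \<eta> lam m k \<le> 1"
begin

text \<open>Base points are pairs \<open>(n, i)\<close> of a level and a branch. Indices outside \<open>J \<eta>\<close>, among
them \<open>0\<close>, get a point mass at \<open>0\<close>: multiplication by \<open>sqrt s\<close> vanishes there. The index
\<open>0\<close> provides the extra branch for the root.\<close>

definition fibre :: "int \<times> nat \<Rightarrow> real measure" where
  "fibre p = (if snd p \<in> J \<eta> then m (snd p) else point_mass_0)"

sublocale fibre_measures fibre
proof (rule fibre_measures.intro)
  show "sets (fibre p) = sets borel" for p by (simp add: fibre_def sets_m)
  show "finite_measure (fibre p)" for p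
    using sets_eq_imp_space_eq[OF sets_m] emeasure_m
    by (auto simp: fibre_def finite_point_mass_0 intro!: finite_measureI)
qed

text \<open>Each base point lies over one vertex; all the branches share the trunk at the levels
\<open>n \<le> 0\<close>.\<close>

definition site :: "int \<times> nat \<Rightarrow> vertex" where
  "site p = (if 1 \<le> fst p then Branch (snd p) (nat (fst p)) else Trunk (nat (- fst p)))"

text \<open>These factors solve \<open>coef (n - 1, i) = lam (site (n, i)) * coef (n, i)\<close>, the recursion that \<open>N U = U S\<close>
imposes, with value one at level \<open>1\<close>.\<close>

definition coef :: "int \<times> nat \<Rightarrow> complex" where
  "coef p = (if 1 \<le> fst p then inverse (\<Prod>j=2..nat (fst p). lam (Branch (snd p) j))
     else lam (Branch (snd p) 1) * (\<Prod>j<nat (- fst p). lam (Trunk j)))"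

definition root_defect :: real where
  "root_defect = 1 - enn2real (trunk_moment \<eta> lam m (the_enat \<kappa>))"

text \<open>The image of the basis vector at \<open>v\<close> is \<open>wt\<close> restricted to the points over \<open>v\<close>. The second case
adds, over the root, the part that makes this vector have norm one.\<close>

definition wt :: "(int \<times> nat) \<times> real \<Rightarrow> complex" where
  "wt = (\<lambda>(p, s).
     if snd p \<in> J \<eta> \<and> site p \<in> tree_V \<eta> \<kappa> then coef p * of_real (sqrt s powi (fst p - 1))
     else if snd p = 0 \<and> fst p \<le> 0 \<and> \<kappa> = enat (nat (- fst p)) then of_real (sqrt root_defect)
     else 0)"

lemma zero_notin_J: "0 \<notin> J \<iota>"
  by (simp add: J_def)

lemma wt_measurable [measurable]: "wt \<in> borel_measurable total"
proof (rule measurable_total)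
  fix p :: "int \<times> nat"
  have [measurable]: "(\<lambda>s::real. sqrt s powi (fst p - 1)) \<in> borel_measurable borel"
    by (simp add: power_int_def)
  show "(\<lambda>s. wt (p, s)) \<in> borel_measurable borel"
    unfolding wt_def prod.case by measurable
qed

lemma site_measurable [measurable]: "(\<lambda>x. site (fst x)) \<in> measurable total (count_space UNIV)"
  by (rule measurable_total) simp

lemma base_cases:
  obtains (branch) j i where "p = (int (Suc j), i)" | (trunk) k i where "p = (- int k, i)"
proof (cases "1 \<le> fst p")
  case True
  then have "p = (int (Suc (nat (fst p) - 1)), snd p)" by (cases p) auto
  then show ?thesis by (rule branch)
next
  case False
  then have "p = (- int (nat (- fst p)), snd p)" by (cases p) auto
  then show ?thesis by (rule trunk)
qed

text \<open>The squared norm of \<open>wt\<close> on one fibre; summed over the fibres that lie over a vertex of the tree it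
has to be one.\<close>

definition mass :: "int \<times> nat \<Rightarrow> ennreal" where
  "mass p = (\<integral>\<^sup>+s. ennreal ((cmod (wt (p, s)))\<^sup>2) \<partial>fibre p)"

lemma mass_branch:
  "mass (int (Suc j), i) = (if i \<in> J \<eta> then 1 else 0)"
proof (cases "i \<in> J \<eta>")
  case True
  note [measurable_cong] = sets_m[OF True]
  let ?c = "\<Prod>j=2..j+1. lam (Branch i j)"
  have c: "?c \<noteq> 0"
    using lam_nonzero True by (auto simp: Branch_nonroot)
  have moment: "(\<integral>\<^sup>+s. ennreal (s ^ j) \<partial>m i) = ennreal ((cmod ?c)\<^sup>2)"
  proof (cases "j = 0")
    case True
    then show ?thesis
      using emeasure_m[OF \<open>i \<in> J \<eta>\<close>] sets_eq_imp_space_eq[OF sets_m[OF \<open>i \<in> J \<eta>\<close>]] by simp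
  next
    case False
    then show ?thesis using branch_moments[of j i] True by simp
  qed
  have "mass (int (Suc j), i) = (\<integral>\<^sup>+s. ennreal ((cmod (inverse ?c))\<^sup>2) * ennreal (s ^ j) \<partial>m i)"
    unfolding mass_def fibre_def
  proof (simp only: True snd_conv if_True, rule nn_integral_cong_AE)
    show "AE s in m i. ennreal ((cmod (wt ((int (Suc j), i), s)))\<^sup>2)
      = ennreal ((cmod (inverse ?c))\<^sup>2) * ennreal (s ^ j)"
      using AE_m_pos[OF True]
    proof eventually_elim
      case (elim s)
      then have "(cmod (wt ((int (Suc j), i), s)))\<^sup>2 = (cmod (inverse ?c))\<^sup>2 * (sqrt s ^ j)\<^sup>2"
        using True
        by (simp add: wt_def site_def Branch_in_tree coef_def norm_mult norm_power power_mult_distrib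
            nat_add_distrib del: norm_inverse prod_inversef)
      also have "(sqrt s ^ j)\<^sup>2 = s ^ j"
        using elim by (simp add: sqrt_power_square)
      finally show ?case using elim by (simp add: ennreal_mult)
    qed
  qed
  also have "\<dots> = ennreal ((cmod (inverse ?c))\<^sup>2) * ennreal ((cmod ?c)\<^sup>2)"
    by (simp add: nn_integral_cmult moment)
  also have "\<dots> = ennreal ((cmod (inverse ?c) * cmod ?c)\<^sup>2)"
    by (simp only: ennreal_mult[symmetric] zero_le_power2 power_mult_distrib)
  also have "\<dots> = 1" using c by (simp flip: norm_mult)
  finally show ?thesis using True by simp
next
  case False
  then show ?thesis by (simp add: mass_def wt_def)
qed

lemma mass_trunk:
  "mass (- int k, i) =
    (if i \<in> J \<eta> then
       (if enat k \<le> \<kappa> then ennreal ((cmod (lam (Branch i 1) * (\<Prod>j<k. lam (Trunk j))))\<^sup>2) *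
        (\<integral>\<^sup>+s. 1 / ennreal (s ^ (k + 1)) \<partial>m i) else 0)
     else if i = 0 \<and> \<kappa> = enat k then ennreal ((cmod (of_real (sqrt root_defect)))\<^sup>2) else 0)"
proof (cases "i \<in> J \<eta>")
  case True
  note [measurable_cong] = sets_m[OF True]
  let ?c = "lam (Branch i 1) * (\<Prod>j<k. lam (Trunk j))"
  show ?thesis
  proof (cases "enat k \<le> \<kappa>")
    case k: True
    have "mass (- int k, i) = (\<integral>\<^sup>+s. ennreal ((cmod ?c)\<^sup>2) * (1 / ennreal (s ^ (k + 1))) \<partial>m i)"
      unfolding mass_def fibre_def
    proof (simp only: True snd_conv if_True, rule nn_integral_cong_AE)
      show "AE s in m i. ennreal ((cmod (wt ((- int k, i), s)))\<^sup>2)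
        = ennreal ((cmod ?c)\<^sup>2) * (1 / ennreal (s ^ (k + 1)))"
        using AE_m_pos[OF True]
      proof eventually_elim
        case (elim s)
        have e: "- int k - 1 = - int (k + 1)" by simp
        have "(cmod (wt ((- int k, i), s)))\<^sup>2 = (cmod ?c)\<^sup>2 * (sqrt s powi (- int k - 1))\<^sup>2"
          using True k elim
          by (simp add: wt_def site_def Trunk_in_tree coef_def norm_mult power_mult_distrib
              norm_power_int)
        also have "(sqrt s powi (- int k - 1))\<^sup>2 = (inverse (sqrt s ^ (k + 1)))\<^sup>2"
          unfolding e power_int_minus power_int_of_nat ..
        also have "\<dots> = 1 / s ^ (k + 1)"
          using elim sqrt_power_square[of s "k + 1"] by (simp add: inverse_eq_divide power_divide)
        finally have eq: "(cmod (wt ((- int k, i), s)))\<^sup>2 = (cmod ?c)\<^sup>2 * (1 / s ^ (k + 1))" .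
        have "1 / ennreal (s ^ (k + 1)) = ennreal (1 / s ^ (k + 1))"
          using elim divide_ennreal[of 1 "s ^ (k + 1)"] by simp
        then show ?case
          unfolding eq by (simp only:) (rule ennreal_mult, use elim in simp_all)
      qed
    qed
    also have "\<dots> = ennreal ((cmod ?c)\<^sup>2) * (\<integral>\<^sup>+s. 1 / ennreal (s ^ (k + 1)) \<partial>m i)"
      by (rule nn_integral_cmult) measurable
    finally show ?thesis using True k by simp
  next
    case False
    then show ?thesis using True zero_notin_J[of \<eta>]
      by (auto simp: mass_def wt_def site_def Trunk_in_tree)
  qed
next
  case False
  then show ?thesis
    by (auto simp: mass_def wt_def fibre_def nn_integral_point_mass_0)
qed

lemma root_defect:
  assumes "\<kappa> = enat k"
  shows "trunk_moment \<eta> lam m k + ennreal ((cmod (of_real (sqrt root_defect)))\<^sup>2) = 1"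
proof -
  have le: "trunk_moment \<eta> lam m k \<le> 1" using trunk_moment_le_1 assms by simp
  then obtain r where r: "0 \<le> r" "trunk_moment \<eta> lam m k = ennreal r"
    using le_less_trans[OF le ennreal_one_less_top] by (cases "trunk_moment \<eta> lam m k") auto
  then have "r \<le> 1" using le by (simp flip: ennreal_1)
  then have "(cmod (of_real (sqrt root_defect)))\<^sup>2 = 1 - r"
    unfolding root_defect_def using r by (simp add: assms)
  then show ?thesis using r \<open>r \<le> 1\<close> by (simp flip: ennreal_plus ennreal_1)
qed

lemma mass_over_trunk:
  "(\<integral>\<^sup>+i. mass (- int k, i) \<partial>count_space UNIV) = indicator (tree_V \<eta> \<kappa>) (Trunk k)"
proof -
  have "mass (- int k, i) =
    (if enat k \<le> \<kappa> then 1 else 0) *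
      (if i \<in> J \<eta> then ennreal ((cmod (lam (Branch i 1) * (\<Prod>j<k. lam (Trunk j))))\<^sup>2) *
        (\<integral>\<^sup>+s. 1 / ennreal (s ^ (k + 1)) \<partial>m i) else 0) +
    (if i = 0 then if \<kappa> = enat k then ennreal ((cmod (of_real (sqrt root_defect)))\<^sup>2) else 0 else 0)" for i
    unfolding mass_trunk using zero_notin_J[of \<eta>] by (auto simp del: norm_of_real)
  then have "(\<integral>\<^sup>+i. mass (- int k, i) \<partial>count_space UNIV) =
      (if enat k \<le> \<kappa> then 1 else 0) * trunk_moment \<eta> lam m k +
      (if \<kappa> = enat k then ennreal ((cmod (of_real (sqrt root_defect)))\<^sup>2) else 0)"
    by (simp only: nn_integral_add nn_integral_cmult nn_integral_count_space_single trunk_moment_def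
        borel_measurable_count_space)
  also have "\<dots> = indicator (tree_V \<eta> \<kappa>) (Trunk k)"
  proof (cases "\<kappa> = enat k")
    case True
    then show ?thesis using root_defect[OF True] by (simp add: Trunk_in_tree del: norm_of_real)
  next
    case False
    then show ?thesis
      using trunk_moment_eq_1[of k] by (auto simp: Trunk_in_tree indicator_def order_le_less)
  qed
  finally show ?thesis .
qed

lemma mass_over_site:
  "(\<integral>\<^sup>+p. (if site p = v then mass p else 0) \<partial>count_space UNIV) = indicator (tree_V \<eta> \<kappa>) v"
proof (cases v)
  case (Trunk k)
  have "(\<integral>\<^sup>+p. (if site p = v then mass p else 0) \<partial>count_space UNIV)
    = (\<integral>\<^sup>+n. \<integral>\<^sup>+i. (if site (n, i) = v then mass (n, i) else 0) \<partial>count_space UNIV \<partial>count_space UNIV)"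
    by (rule nn_integral_fst_count_space[symmetric])
  also have "\<dots> = (\<integral>\<^sup>+n. (if n = - int k then indicator (tree_V \<eta> \<kappa>) v else 0) \<partial>count_space UNIV)"
  proof (rule nn_integral_cong)
    fix n :: int
    have "site (n, i) = v \<longleftrightarrow> n = - int k" for i by (auto simp: site_def Trunk)
    then show "(\<integral>\<^sup>+i. (if site (n, i) = v then mass (n, i) else 0) \<partial>count_space UNIV)
      = (if n = - int k then indicator (tree_V \<eta> \<kappa>) v else 0)"
      using mass_over_trunk[of k] by (simp add: Trunk)
  qed
  finally show ?thesis by (simp add: nn_integral_count_space_single)
next
  case (Branch i j)
  show ?thesis
  proof (cases j)
    case 0
    then have "site p \<noteq> v" for p by (auto simp: site_def Branch)
    then show ?thesis using 0 by (simp add: Branch Branch_in_tree)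
  next
    case (Suc j')
    have "site p = v \<longleftrightarrow> p = (int (Suc j'), i)" for p
      by (cases p) (auto simp: site_def Branch Suc)
    then have "(\<integral>\<^sup>+p. (if site p = v then mass p else 0) \<partial>count_space UNIV)
      = (\<integral>\<^sup>+p. (if p = (int (Suc j'), i) then mass (int (Suc j'), i) else 0) \<partial>count_space UNIV)"
      by (intro nn_integral_cong) auto
    then show ?thesis
      by (simp only: nn_integral_count_space_single mass_branch) (simp add: Branch Branch_in_tree Suc indicator_def)
  qed
qed

text \<open>This identity of measures states at once that the images of the basis vectors at the vertices of the
tree have norm one; it transfers norms and inner products between the two spaces by a change of
variables.\<close>

lemma distr_site:
  "distr (density total (\<lambda>x. ennreal ((cmod (wt x))\<^sup>2))) (count_space UNIV) (\<lambda>x. site (fst x))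
    = density (count_space UNIV) (indicator (tree_V \<eta> \<kappa>))"
proof (rule measure_eqI_countable[of _ UNIV])
  fix v
  let ?d = "\<lambda>x. ennreal ((cmod (wt x))\<^sup>2)"
  have vim: "(\<lambda>x. site (fst x)) -` {v} \<in> sets total"
    using measurable_sets[OF site_measurable, of "{v}"] by simp
  have "emeasure (distr (density total ?d) (count_space UNIV) (\<lambda>x. site (fst x))) {v}
    = emeasure (density total ?d) ((\<lambda>x. site (fst x)) -` {v})"
    by (subst emeasure_distr) auto
  also have "\<dots> = (\<integral>\<^sup>+x. ?d x * indicator ((\<lambda>x. site (fst x)) -` {v}) x \<partial>total)"
    by (rule emeasure_density[OF _ vim]) measurable
  also have "\<dots> = (\<integral>\<^sup>+p. \<integral>\<^sup>+s. ?d (p, s) * indicator ((\<lambda>x. site (fst x)) -` {v}) (p, s) \<partial>fibre p \<partial>count_space UNIV)"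
  proof (rule nn_integral_total)
    have [measurable]: "(indicator ((\<lambda>x. site (fst x)) -` {v}) :: _ \<Rightarrow> ennreal) \<in> borel_measurable total"
      by (rule borel_measurable_indicator[OF vim])
    show "(\<lambda>x. ?d x * indicator ((\<lambda>x. site (fst x)) -` {v}) x) \<in> borel_measurable total"
      by measurable
  qed
  also have "\<dots> = (\<integral>\<^sup>+p. (if site p = v then mass p else 0) \<partial>count_space UNIV)"
    by (intro nn_integral_cong) (auto simp: mass_def)
  also have "\<dots> = emeasure (density (count_space UNIV) (indicator (tree_V \<eta> \<kappa>))) {v}"
    by (simp add: mass_over_site emeasure_density nn_integral_indicator_singleton)
  finally show "emeasure (distr (density total ?d) (count_space UNIV) (\<lambda>x. site (fst x))) {v}
    = emeasure (density (count_space UNIV) (indicator (tree_V \<eta> \<kappa>))) {v}" .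
qed auto

text \<open>The isometry before coding: different vertices are carried by disjoint sets, so a vector acts as a
coefficient that is constant over each vertex.\<close>

definition lift :: "(vertex \<Rightarrow> complex) \<Rightarrow> (int \<times> nat) \<times> real \<Rightarrow> complex" where
  "lift f x = f (site (fst x)) * wt x"

lemma lift_measurable [measurable]: "lift f \<in> borel_measurable total"
  unfolding lift_def[abs_def] by measurable

lemma integral_site:
  fixes h :: "vertex \<Rightarrow> complex"
  assumes "\<And>v. v \<notin> tree_V \<eta> \<kappa> \<Longrightarrow> h v = 0"
  shows "(\<integral>x. (cmod (wt x))\<^sup>2 *\<^sub>R h (site (fst x)) \<partial>total) = (\<integral>v. h v \<partial>count_space UNIV)"
proof -
  have "(\<integral>x. (cmod (wt x))\<^sup>2 *\<^sub>R h (site (fst x)) \<partial>total)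
    = (\<integral>x. h (site (fst x)) \<partial>density total (\<lambda>x. ennreal ((cmod (wt x))\<^sup>2)))"
    by (rule integral_density[symmetric]) auto
  also have "\<dots> = (\<integral>v. h v \<partial>distr (density total (\<lambda>x. ennreal ((cmod (wt x))\<^sup>2))) (count_space UNIV) (\<lambda>x. site (fst x)))"
    by (rule integral_distr[symmetric]) auto
  also have "\<dots> = (\<integral>v. h v \<partial>density (count_space UNIV) (\<lambda>v. ennreal (indicator (tree_V \<eta> \<kappa>) v)))"
    by (simp add: distr_site ennreal_indicator)
  also have "\<dots> = (\<integral>v. indicator (tree_V \<eta> \<kappa>) v *\<^sub>R h v \<partial>count_space UNIV)"
    by (rule integral_density) auto
  also have "\<dots> = (\<integral>v. h v \<partial>count_space UNIV)"
    by (rule Bochner_Integration.integral_cong) (use assms in \<open>auto simp: indicator_def\<close>)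
  finally show ?thesis .
qed

lemma lift_L2:
  assumes f: "f \<in> carrier (ell2 (tree_V \<eta> \<kappa>))"
  shows "lift f \<in> L2 total"
proof -
  have "(\<integral>\<^sup>+x. ennreal ((cmod (lift f x))\<^sup>2) \<partial>total)
    = (\<integral>\<^sup>+x. ennreal ((cmod (wt x))\<^sup>2) * ennreal ((cmod (f (site (fst x))))\<^sup>2) \<partial>total)"
    by (simp add: lift_def norm_mult power_mult_distrib ennreal_mult mult.commute)
  also have "\<dots> = (\<integral>\<^sup>+x. ennreal ((cmod (f (site (fst x))))\<^sup>2) \<partial>density total (\<lambda>x. ennreal ((cmod (wt x))\<^sup>2)))"
    by (rule nn_integral_density[symmetric]) auto
  also have "\<dots> = (\<integral>\<^sup>+v. ennreal ((cmod (f v))\<^sup>2)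
      \<partial>distr (density total (\<lambda>x. ennreal ((cmod (wt x))\<^sup>2))) (count_space UNIV) (\<lambda>x. site (fst x)))"
    by (rule nn_integral_distr[symmetric]) auto
  also have "\<dots> = (\<integral>\<^sup>+v. indicator (tree_V \<eta> \<kappa>) v * ennreal ((cmod (f v))\<^sup>2) \<partial>count_space UNIV)"
    unfolding distr_site by (rule nn_integral_density) auto
  also have "\<dots> \<le> (\<integral>\<^sup>+v. ennreal ((cmod (f v))\<^sup>2) \<partial>count_space UNIV)"
    by (rule nn_integral_mono) (auto simp: indicator_def)
  also have "\<dots> < \<infinity>"
    using f by (simp add: carrier_ell2_iff L2_iff_nn_integral)
  finally show ?thesis by (simp add: L2_iff_nn_integral)
qed

lemma inner_lift:
  assumes f: "f \<in> carrier (ell2 (tree_V \<eta> \<kappa>))" and g: "g \<in> carrier (ell2 (tree_V \<eta> \<kappa>))"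
  shows "(\<integral>x. lift f x * cnj (lift g x) \<partial>total) = inner_prod (ell2 (tree_V \<eta> \<kappa>)) f g"
proof -
  have "lift f x * cnj (lift g x) = (cmod (wt x))\<^sup>2 *\<^sub>R (f (site (fst x)) * cnj (g (site (fst x))))" for x
    by (simp only: lift_def scaleR_conv_of_real complex_norm_square complex_cnj_mult mult_ac)
  then have "(\<integral>x. lift f x * cnj (lift g x) \<partial>total) = (\<integral>v. f v * cnj (g v) \<partial>count_space UNIV)"
    using integral_site[of "\<lambda>v. f v * cnj (g v)"] f by (simp add: carrier_ell2_iff)
  then show ?thesis by (simp add: inner_ell2[OF f g])
qed

definition up :: "(int \<times> nat) \<times> real \<Rightarrow> (int \<times> nat) \<times> real" where
  "up = (\<lambda>(p, s). ((fst p + 1, snd p), s))"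

definition down :: "(int \<times> nat) \<times> real \<Rightarrow> (int \<times> nat) \<times> real" where
  "down = (\<lambda>(p, s). ((fst p - 1, snd p), s))"

lemma weighted_translation_tree:
  "weighted_translation total ray_code down up (\<lambda>x. sqrt (snd x))"
proof -
  interpret coded_L2 total ray_code by (rule coded_L2_ray_code)
  have b: "bij (\<lambda>p::int \<times> nat. (fst p + 1, snd p))" "bij (\<lambda>p::int \<times> nat. (fst p - 1, snd p))"
    by (rule bij_betw_byWitness[where f'="\<lambda>p. (fst p - 1, snd p)"]; simp)
      (rule bij_betw_byWitness[where f'="\<lambda>p. (fst p + 1, snd p)"]; simp)
  show ?thesis
  proof
    show "up \<in> measurable total total" "distr total total up = total"
      "down \<in> measurable total total" "distr total total down = total"
      unfolding up_def down_def
      using distr_total_base_bij[OF b(1)] distr_total_base_bij[OF b(2)] by (simp_all add: fibre_def)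
    show "(\<lambda>x. sqrt (snd x)) \<in> borel_measurable total"
      by (rule measurable_total) simp
  qed (auto simp: up_def down_def split: prod.splits)
qed

text \<open>Where \<open>s > 0\<close> this is the recursion for \<open>coef\<close> together with \<open>sqrt s * sqrt s\<^bsup>n - 2\<^esup> = sqrt s\<^bsup>n - 1\<^esup>\<close>.
On the extra branches \<open>s = 0\<close> almost everywhere; there the left side is zero, and so is the
right side, because \<open>wt\<close> is supported over the root, where the shift of \<open>f\<close> vanishes. One level below the root, \<open>f\<close>
itself vanishes.\<close>

lemma lift_intertwines:
  assumes f: "\<And>v. v \<notin> tree_V \<eta> \<kappa> \<Longrightarrow> f v = 0"
  shows "AE x in total. of_real (sqrt (snd x)) * lift f (down x)
    = lift (shift_map (tree_V \<eta> \<kappa>) (tree_E \<eta> \<kappa>) lam f) x"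
proof (rule AE_totalI)
  interpret weighted_translation total ray_code down up "\<lambda>x. sqrt (snd x)"
    by (rule weighted_translation_tree)
  let ?S = "shift_map (tree_V \<eta> \<kappa>) (tree_E \<eta> \<kappa>) lam f"
  show "Measurable.pred total (\<lambda>x. of_real (sqrt (snd x)) * lift f (down x) = lift ?S x)"
    by measurable
  fix p
  show "AE s in fibre p. of_real (sqrt (snd (p, s))) * lift f (down (p, s)) = lift ?S (p, s)"
  proof (cases "snd p \<in> J \<eta>")
    case i: True
    have pow: "of_real (sqrt s) * of_real (sqrt s powi (n - 1)) = (of_real (sqrt s powi n) :: complex)"
      if "0 < s" for s n
      using arg_cong[OF power_int_add_1'[of "sqrt s" "n - 1"], of complex_of_real] that by simp
    have "of_real (sqrt s) * lift f (down (p, s)) = lift ?S (p, s)" if s: "0 < s" for s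
    proof (cases p rule: base_cases)
      case (branch j i)
      then have i: "i \<in> J \<eta>" using i by simp
      show ?thesis
      proof (cases j)
        case 0
        have "0 \<le> \<kappa>" by simp
        then have "of_real (sqrt s) * lift f (down (p, s))
          = lam (Branch i 1) * f (Trunk 0) * (of_real (sqrt s) * of_real (sqrt s powi (0 - 1)))"
          using i by (simp add: lift_def down_def wt_def site_def branch 0 coef_def Trunk_in_tree zero_enat_def)
        also have "\<dots> = lift ?S (p, s)"
          using i unfolding pow[OF s]
          by (simp add: lift_def wt_def site_def branch 0 coef_def shift_map_tree_simps Branch_in_tree)
        finally show ?thesis .
      next
        case (Suc j')
        let ?c = "\<Prod>j=2..j'+1. lam (Branch i j)"
        have nz: "lam (Branch i (Suc (Suc j'))) \<noteq> 0"
          using lam_nonzero i by (simp add: Branch_nonroot)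
        have "of_real (sqrt s) * lift f (down (p, s))
          = inverse ?c * f (Branch i (Suc j')) * (of_real (sqrt s) * of_real (sqrt s powi (int (Suc j') - 1)))"
          using i by (simp add: lift_def down_def wt_def site_def branch Suc coef_def Branch_in_tree nat_add_distrib)
        also have "\<dots> = lift ?S (p, s)"
          using i nz unfolding pow[OF s]
          by (simp add: lift_def wt_def site_def branch Suc coef_def shift_map_tree_simps Branch_in_tree
              nat_add_distrib prod.nat_ivl_Suc')
        finally show ?thesis .
      qed
    next
      case (trunk k i)
      then have i: "i \<in> J \<eta>" using i by simp
      show ?thesis
      proof (cases "enat (Suc k) \<le> \<kappa>")
        case True
        then have k: "enat k \<le> \<kappa>" by (rule order_trans[rotated]) simp
        have e: "nat (1 + int k) = Suc k" by simp
        have "of_real (sqrt s) * lift f (down (p, s))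
          = lam (Branch i 1) * (\<Prod>j<Suc k. lam (Trunk j)) * f (Trunk (Suc k)) *
            (of_real (sqrt s) * of_real (sqrt s powi ((- int k - 1) - 1)))"
          using i True by (simp add: lift_def down_def wt_def site_def trunk coef_def Trunk_in_tree e)
        also have "\<dots> = lift ?S (p, s)"
          using i True k unfolding pow[OF s]
          by (simp add: lift_def wt_def site_def trunk coef_def shift_map_tree_simps Trunk_in_tree)
        finally show ?thesis .
      next
        case False
        have e: "nat (1 + int k) = Suc k" by simp
        have "f (Trunk (Suc k)) = 0" by (rule f) (simp add: Trunk_in_tree False)
        then show ?thesis
          using False by (simp add: lift_def down_def site_def trunk shift_map_tree_simps e)
      qed
    qed
    moreover have "AE s in fibre p. 0 < s" using AE_m_pos[OF i] i unfolding fibre_def by simp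
    ultimately show ?thesis by (auto elim!: eventually_mono)
  next
    case i: False
    have "lift ?S (p, 0) = 0"
    proof (cases p rule: base_cases)
      case (branch j i)
      then show ?thesis using i by (simp add: lift_def site_def shift_map_tree_simps)
    next
      case (trunk k i)
      then show ?thesis using i by (auto simp: lift_def site_def wt_def shift_map_tree_simps)
    qed
    then have "of_real (sqrt s) * lift f (down (p, s)) = lift ?S (p, s)" if "s = 0" for s
      using that by simp
    moreover have "AE s in fibre p. s = 0" using AE_point_mass_0 i unfolding fibre_def by simp
    ultimately show ?thesis by (auto elim!: eventually_mono)
  qed
qed

theorem subnormal_tree_shift:
  assumes e0: "indicator {Trunk 0} \<in> C_infinity_domain (ell2 (tree_V \<eta> \<kappa>)) (tree_shift \<eta> \<kappa> lam)"
  shows "subnormal (ell2 (tree_V \<eta> \<kappa>)) (tree_shift \<eta> \<kappa> lam)"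
proof -
  interpret weighted_translation total ray_code down up "\<lambda>x. sqrt (snd x)"
    by (rule weighted_translation_tree)
  let ?H = "ell2 (tree_V \<eta> \<kappa>)"
  let ?U = "\<lambda>f. ray_code (lift f)"
  have iso: "linear_isometry ?H space_L2 ?U"
    unfolding linear_isometry_def
  proof (intro conjI ballI allI)
    show "?U \<in> carrier ?H \<rightarrow> carrier space_L2"
      using lift_L2 by (auto simp: carrier_L2)
  next
    fix f g assume f: "f \<in> carrier ?H" and g: "g \<in> carrier ?H"
    have "lift (f \<oplus>\<^bsub>?H\<^esub> g) = (\<lambda>x. lift f x + lift g x)"
      by (simp add: lift_def ell2_simps distrib_right fun_eq_iff)
    then show "?U (f \<oplus>\<^bsub>?H\<^esub> g) = ?U f \<oplus>\<^bsub>space_L2\<^esub> ?U g"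
      by (simp add: add_code lift_L2 f g)
    show "inner_prod space_L2 (?U f) (?U g) = inner_prod ?H f g"
      by (simp add: inner_code lift_L2 f g inner_lift)
  next
    fix c f assume f: "f \<in> carrier ?H"
    have "lift (c \<odot>\<^bsub>?H\<^esub> f) = (\<lambda>x. c * lift f x)"
      by (simp add: lift_def ell2_simps mult.assoc fun_eq_iff)
    then show "?U (c \<odot>\<^bsub>?H\<^esub> f) = c \<odot>\<^bsub>space_L2\<^esub> ?U f"
      by (simp add: smult_code lift_L2 f)
  qed
  have ext: "(?U h, ?U g) \<in> translation_op" if "(h, g) \<in> tree_shift \<eta> \<kappa> lam" for h g
  proof -
    from that have h: "h \<in> carrier ?H" and g: "g \<in> carrier ?H"
      and gh: "g = shift_map (tree_V \<eta> \<kappa>) (tree_E \<eta> \<kappa>) lam h"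
      by (auto simp: weighted_shift_def)
    have ae: "AE x in total. of_real (sqrt (snd x)) * lift h (down x) = lift g x"
      unfolding gh by (rule lift_intertwines) (use h in \<open>auto simp: carrier_ell2_iff\<close>)
    then have "(\<lambda>x. of_real (sqrt (snd x)) * lift h (down x)) \<in> L2 total"
      by (intro L2_cong_AE[OF lift_L2[OF g]]) auto
    then show ?thesis
      using ae by (auto simp: translation_op_iff lift_L2 h g code_eq_iff)
  qed
  show ?thesis
    unfolding subnormal_def
    using linear_operator_weighted_shift iso ext hilbert_space_L2 normal_translation
      densely_defined_weighted_shift[OF basis_in_domain_tree_shift[OF e0]]
    by blast
qed

end

section \<open>From integral conditions to the norms of the trunk vectors\<close>

lemma infsum_ennreal_eq_nn_integral:
  fixes f :: "nat \<Rightarrow> ennreal"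
  shows "(\<Sum>\<^sub>\<infinity>i\<in>A. f i) = (\<integral>\<^sup>+i. (if i \<in> A then f i else 0) \<partial>count_space UNIV)"
proof -
  let ?g = "\<lambda>i. if i \<in> A then f i else 0"
  have "(\<Sum>\<^sub>\<infinity>i\<in>A. f i) = (\<Sum>\<^sub>\<infinity>i. ?g i)"
    by (rule infsum_cong_neutral) auto
  also have "\<dots> = (\<Sum>i. ?g i)"
    by (rule sums_unique[OF has_sum_imp_sums[OF has_sum_infsum[OF nonneg_summable_on_complete]]]) simp
  also have "\<dots> = (\<integral>\<^sup>+i. ?g i \<partial>count_space UNIV)"
    by (simp add: nn_integral_count_space_nat)
  finally show ?thesis .
qed

text \<open>Indicators generate the nonnegative functions; the sum over \<open>i\<close> is written as an integral over the
counting measure so that monotone convergence applies to it as well.\<close>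

lemma nn_integral_eq_sum_if_measures_eq_sum:
  fixes N :: "real measure" and m :: "nat \<Rightarrow> real measure"
  assumes [measurable_cong]: "sets N = sets borel" "\<And>i. sets (m i) = sets borel"
    and [measurable]: "g \<in> borel_measurable borel" "\<And>i. h i \<in> borel_measurable borel"
    and eq: "\<And>A. A \<in> sets borel \<Longrightarrow> (\<integral>\<^sup>+s. indicator A s * g s \<partial>N)
      = (\<integral>\<^sup>+i. \<integral>\<^sup>+s. indicator A s * h i s \<partial>m i \<partial>count_space UNIV)"
    and f: "f \<in> borel_measurable borel"
  shows "(\<integral>\<^sup>+s. f s * g s \<partial>N) = (\<integral>\<^sup>+i. \<integral>\<^sup>+s. f s * h i s \<partial>m i \<partial>count_space UNIV)"
  using f
proof (induction rule: borel_measurable_induct)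
  case (cong f f')
  then have "f = f'" by auto
  with cong show ?case by simp
next
  case (set A)
  then show ?case by (rule eq)
next
  case (mult u c)
  note [measurable] = mult.hyps(2)
  have "(\<integral>\<^sup>+s. c * u s * g s \<partial>N) = c * (\<integral>\<^sup>+s. u s * g s \<partial>N)"
    unfolding mult.assoc by (rule nn_integral_cmult) measurable
  moreover have "(\<integral>\<^sup>+s. c * u s * h i s \<partial>m i) = c * (\<integral>\<^sup>+s. u s * h i s \<partial>m i)" for i
    unfolding mult.assoc by (rule nn_integral_cmult) measurable
  ultimately show ?case using mult.IH by (simp add: nn_integral_cmult)
next
  case (add u v)
  note [measurable] = add.hyps(1,3)
  have "(\<integral>\<^sup>+s. (v s + u s) * g s \<partial>N) = (\<integral>\<^sup>+s. v s * g s \<partial>N) + (\<integral>\<^sup>+s. u s * g s \<partial>N)"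
    unfolding distrib_right by (rule nn_integral_add) measurable
  moreover have "(\<integral>\<^sup>+s. (v s + u s) * h i s \<partial>m i) = (\<integral>\<^sup>+s. v s * h i s \<partial>m i) + (\<integral>\<^sup>+s. u s * h i s \<partial>m i)" for i
    unfolding distrib_right by (rule nn_integral_add) measurable
  ultimately show ?case using add.IH by (simp add: nn_integral_add)
next
  case (seq U)
  note [measurable] = seq.hyps(1)
  have inc: "incseq (\<lambda>i s. U i s * w s)" for w
    using seq.hyps(3) by (auto simp: incseq_def le_fun_def intro: mult_right_mono)
  have SUP: "(SUP i. U i) s * w = (SUP i. U i s * w)" for s w
    unfolding SUP_apply by (rule SUP_mult_right_ennreal)
  have "(\<integral>\<^sup>+s. (SUP i. U i) s * g s \<partial>N) = (SUP i. \<integral>\<^sup>+s. U i s * g s \<partial>N)"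
    unfolding SUP by (rule nn_integral_monotone_convergence_SUP[OF inc]) measurable
  also have "\<dots> = (SUP j. \<integral>\<^sup>+i. \<integral>\<^sup>+s. U j s * h i s \<partial>m i \<partial>count_space UNIV)"
    using seq.IH by simp
  also have "\<dots> = (\<integral>\<^sup>+i. (SUP j. \<integral>\<^sup>+s. U j s * h i s \<partial>m i) \<partial>count_space UNIV)"
  proof (rule nn_integral_monotone_convergence_SUP[symmetric])
    show "incseq (\<lambda>j i. \<integral>\<^sup>+s. U j s * h i s \<partial>m i)"
      using inc by (auto simp: incseq_def le_fun_def intro!: nn_integral_mono)
  qed simp
  also have "\<dots> = (\<integral>\<^sup>+i. \<integral>\<^sup>+s. (SUP j. U j) s * h i s \<partial>m i \<partial>count_space UNIV)"
    unfolding SUP by (intro nn_integral_cong nn_integral_monotone_convergence_SUP[symmetric] inc) measurable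
  finally show ?case .
qed

definition extend_to_line :: "real measure \<Rightarrow> real measure" where
  "extend_to_line M = distr M borel (\<lambda>s. s)"

lemma sets_extend_to_line [simp, measurable_cong]: "sets (extend_to_line M) = sets borel"
  by (simp add: extend_to_line_def)

context
  fixes M :: "real measure"
  assumes M: "borel_prob_halfline M"
begin

lemma space_halfline: "space M = {0..}"
  using M sets_eq_imp_space_eq[of M "restrict_space borel {0..}"]
  by (simp add: borel_prob_halfline_def space_restrict_space)

lemma measurable_halfline: "(\<lambda>s. s) \<in> measurable M borel"
proof -
  have "(\<lambda>s::real. s) \<in> measurable (restrict_space borel {0..}) borel"
    by (rule measurable_restrict_space1) simp
  then show ?thesis
    using M measurable_cong_sets[of M "restrict_space borel {0..}" "borel :: real measure" borel]
    by (simp add: borel_prob_halfline_def)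
qed

lemma nn_integral_extend_to_line:
  "f \<in> borel_measurable borel \<Longrightarrow> (\<integral>\<^sup>+s. f s \<partial>extend_to_line M) = (\<integral>\<^sup>+s. f s \<partial>M)"
  unfolding extend_to_line_def by (rule nn_integral_distr[OF measurable_halfline]) simp

lemma emeasure_extend_to_line: "emeasure (extend_to_line M) UNIV = 1"
  using M by (simp add: extend_to_line_def emeasure_distr[OF measurable_halfline] borel_prob_halfline_def)

lemma AE_extend_to_line: "AE s in extend_to_line M. 0 \<le> s"
  unfolding extend_to_line_def
  by (subst AE_distr_iff[OF measurable_halfline]) (auto simp: space_halfline intro: AE_I2)

end

definition branch_sum :: "enat \<Rightarrow> (vertex \<Rightarrow> complex) \<Rightarrow> (nat \<Rightarrow> real measure) \<Rightarrow> nat \<Rightarrow> ennreal" where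
  "branch_sum \<eta> lam \<mu> l = (\<Sum>\<^sub>\<infinity>i\<in>J \<eta>. ennreal ((cmod (lam (Branch i 1)))\<^sup>2) *
     (\<integral>\<^sup>+s. 1 / ennreal (s ^ (l + 1)) \<partial>\<mu> i))"

abbreviation (input) trunk_weight :: "(vertex \<Rightarrow> complex) \<Rightarrow> nat \<Rightarrow> ennreal" where
  "trunk_weight lam k \<equiv> ennreal ((cmod (\<Prod>j<k. lam (Trunk j)))\<^sup>2)"

context
  fixes \<eta> :: enat and lam :: "vertex \<Rightarrow> complex" and \<mu> :: "nat \<Rightarrow> real measure"
  assumes prob: "\<And>i. i \<in> J \<eta> \<Longrightarrow> borel_prob_halfline (\<mu> i)"
begin

lemma trunk_moment_eq:
  "trunk_moment \<eta> lam (\<lambda>i. extend_to_line (\<mu> i)) k = trunk_weight lam k * branch_sum \<eta> lam \<mu> k"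
proof -
  have "trunk_moment \<eta> lam (\<lambda>i. extend_to_line (\<mu> i)) k
    = (\<integral>\<^sup>+i. trunk_weight lam k * (if i \<in> J \<eta> then ennreal ((cmod (lam (Branch i 1)))\<^sup>2) *
        (\<integral>\<^sup>+s. 1 / ennreal (s ^ (k + 1)) \<partial>\<mu> i) else 0) \<partial>count_space UNIV)"
    unfolding trunk_moment_def
    by (intro nn_integral_cong)
      (auto simp: nn_integral_extend_to_line prob norm_mult power_mult_distrib ennreal_mult mult_ac)
  also have "\<dots> = trunk_weight lam k * branch_sum \<eta> lam \<mu> k"
    unfolding branch_sum_def infsum_ennreal_eq_nn_integral by (rule nn_integral_cmult) simp
  finally show ?thesis .
qed

text \<open>An atom of \<open>\<mu> i\<close> at \<open>0\<close> would make the integral of \<open>1/s\<close> infinite, and the weight in front of it is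
not zero.\<close>

lemma AE_pos_if_trunk_moment_finite:
  assumes fin: "trunk_moment \<eta> lam (\<lambda>i. extend_to_line (\<mu> i)) 0 \<le> 1"
    and i: "i \<in> J \<eta>" and nz: "lam (Branch i 1) \<noteq> 0"
  shows "AE s in extend_to_line (\<mu> i). 0 < s"
proof -
  let ?m = "extend_to_line (\<mu> i)"
  have "ennreal ((cmod (lam (Branch i 1)))\<^sup>2) * (\<integral>\<^sup>+s. 1 / ennreal s \<partial>?m)
    \<le> trunk_moment \<eta> lam (\<lambda>i. extend_to_line (\<mu> i)) 0"
    unfolding trunk_moment_def
    by (rule order_trans[OF _ nn_integral_ge_point[of i]]) (use i in auto)
  also have "\<dots> < \<infinity>" using le_less_trans[OF fin ennreal_one_less_top] by simp
  finally have "(\<integral>\<^sup>+s. 1 / ennreal s \<partial>?m) \<noteq> \<infinity>"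
    using nz by (auto simp: ennreal_mult_eq_top_iff less_top[symmetric])
  then have "AE s in ?m. 1 / ennreal s \<noteq> \<infinity>"
    by (intro nn_integral_noteq_infinite) auto
  then show ?thesis
    using AE_extend_to_line[OF prob[OF i]]
    by eventually_elim (auto simp: order_le_less ennreal_divide_eq_top_iff)
qed

text \<open>Integrate \<open>1/s\<^sup>l\<close> against both sides of the identity of measures. On the right this gives
\<open>trunk_weight k * branch_sum l\<close>. On the left it gives the moment of order \<open>k - l\<close> of \<open>\<nu>\<close>, which is
the quotient of \<open>trunk_weight k\<close> by \<open>trunk_weight l\<close>; for \<open>l = k\<close> it is the measure of the open
half-line, since \<open>1/0\<close> times \<open>0\<close> is \<open>0\<close>.\<close>

lemma trunk_moments_of_measure:
  fixes \<nu> :: "real measure"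
  assumes \<nu>: "borel_prob_halfline \<nu>" and k: "0 < k"
    and nz: "\<And>j. j < k \<Longrightarrow> lam (Trunk j) \<noteq> 0"
    and mom: "\<And>n. 1 \<le> n \<Longrightarrow> n \<le> k \<Longrightarrow> (\<integral>\<^sup>+s. ennreal (s ^ n) \<partial>\<nu>) =
      ennreal ((cmod (\<Prod>j=k-n..<k. lam (Trunk j)))\<^sup>2)"
    and eq: "\<And>\<sigma>. \<sigma> \<in> sets (restrict_space borel {0..}) \<Longrightarrow>
      (\<integral>\<^sup>+s\<in>\<sigma>. ennreal (s ^ k) \<partial>\<nu>) = trunk_weight lam k *
        (\<Sum>\<^sub>\<infinity>i\<in>J \<eta>. ennreal ((cmod (lam (Branch i 1)))\<^sup>2) * (\<integral>\<^sup>+s\<in>\<sigma>. 1 / ennreal s \<partial>\<mu> i))"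
  shows "l < k \<Longrightarrow> trunk_weight lam l * branch_sum \<eta> lam \<mu> l = 1"
    and "trunk_weight lam k * branch_sum \<eta> lam \<mu> k \<le> 1"
proof -
  define h where "h i s = (if i \<in> J \<eta> then
    trunk_weight lam k * ennreal ((cmod (lam (Branch i 1)))\<^sup>2) * (1 / ennreal s) else 0)" for i s
  have [measurable]: "h i \<in> borel_measurable borel" for i
    unfolding h_def by measurable
  have ind: "(\<integral>\<^sup>+s. indicator A s * ennreal (s ^ k) \<partial>extend_to_line \<nu>)
      = (\<integral>\<^sup>+i. \<integral>\<^sup>+s. indicator A s * h i s \<partial>extend_to_line (\<mu> i) \<partial>count_space UNIV)"
    if A [measurable]: "A \<in> sets borel" for A
  proof -
    let ?\<sigma> = "A \<inter> {0..}"
    have \<sigma>: "?\<sigma> \<in> sets (restrict_space borel {0..})"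
      using A by (auto simp: sets_restrict_space)
    have "(\<integral>\<^sup>+s. indicator A s * ennreal (s ^ k) \<partial>extend_to_line \<nu>) = (\<integral>\<^sup>+s. indicator A s * ennreal (s ^ k) \<partial>\<nu>)"
      by (rule nn_integral_extend_to_line[OF \<nu>]) measurable
    also have "\<dots> = (\<integral>\<^sup>+s\<in>?\<sigma>. ennreal (s ^ k) \<partial>\<nu>)"
      by (rule nn_integral_cong) (auto simp: space_halfline[OF \<nu>] indicator_def)
    also have "\<dots> = (\<integral>\<^sup>+i. trunk_weight lam k * (if i \<in> J \<eta> then ennreal ((cmod (lam (Branch i 1)))\<^sup>2) *
        (\<integral>\<^sup>+s\<in>?\<sigma>. 1 / ennreal s \<partial>\<mu> i) else 0) \<partial>count_space UNIV)"
      unfolding eq[OF \<sigma>] infsum_ennreal_eq_nn_integral by (rule nn_integral_cmult[symmetric]) simp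
    also have "\<dots> = (\<integral>\<^sup>+i. \<integral>\<^sup>+s. indicator A s * h i s \<partial>extend_to_line (\<mu> i) \<partial>count_space UNIV)"
    proof (rule nn_integral_cong)
      fix i
      show "trunk_weight lam k * (if i \<in> J \<eta> then ennreal ((cmod (lam (Branch i 1)))\<^sup>2) *
          (\<integral>\<^sup>+s\<in>?\<sigma>. 1 / ennreal s \<partial>\<mu> i) else 0)
        = (\<integral>\<^sup>+s. indicator A s * h i s \<partial>extend_to_line (\<mu> i))"
      proof (cases "i \<in> J \<eta>")
        case True
        let ?c = "trunk_weight lam k * ennreal ((cmod (lam (Branch i 1)))\<^sup>2)"
        have "(\<integral>\<^sup>+s. indicator A s * h i s \<partial>extend_to_line (\<mu> i))
          = (\<integral>\<^sup>+s. ?c * (indicator A s * (1 / ennreal s)) \<partial>extend_to_line (\<mu> i))"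
          using True by (simp add: h_def mult_ac)
        also have "\<dots> = ?c * (\<integral>\<^sup>+s. indicator A s * (1 / ennreal s) \<partial>extend_to_line (\<mu> i))"
          by (rule nn_integral_cmult) measurable
        also have "(\<integral>\<^sup>+s. indicator A s * (1 / ennreal s) \<partial>extend_to_line (\<mu> i))
          = (\<integral>\<^sup>+s. indicator A s * (1 / ennreal s) \<partial>\<mu> i)"
          by (rule nn_integral_extend_to_line[OF prob[OF True]]) measurable
        also have "\<dots> = (\<integral>\<^sup>+s\<in>?\<sigma>. 1 / ennreal s \<partial>\<mu> i)"
          by (rule nn_integral_cong) (auto simp: space_halfline[OF prob[OF True]] indicator_def)
        finally show ?thesis using True by (simp add: mult.assoc)
      qed (simp add: h_def)
    qed
    finally show ?thesis .
  qed
  have moment: "(\<integral>\<^sup>+s. 1 / ennreal (s ^ l) * ennreal (s ^ k) \<partial>extend_to_line \<nu>)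
      = trunk_weight lam k * branch_sum \<eta> lam \<mu> l" for l
  proof -
    have "(\<integral>\<^sup>+s. 1 / ennreal (s ^ l) * ennreal (s ^ k) \<partial>extend_to_line \<nu>)
      = (\<integral>\<^sup>+i. \<integral>\<^sup>+s. 1 / ennreal (s ^ l) * h i s \<partial>extend_to_line (\<mu> i) \<partial>count_space UNIV)"
      by (rule nn_integral_eq_sum_if_measures_eq_sum[OF _ _ _ _ ind]) auto
    also have "\<dots> = (\<integral>\<^sup>+i. trunk_weight lam k * (if i \<in> J \<eta> then ennreal ((cmod (lam (Branch i 1)))\<^sup>2) *
        (\<integral>\<^sup>+s. 1 / ennreal (s ^ (l + 1)) \<partial>\<mu> i) else 0) \<partial>count_space UNIV)"
    proof (rule nn_integral_cong)
      fix i
      show "(\<integral>\<^sup>+s. 1 / ennreal (s ^ l) * h i s \<partial>extend_to_line (\<mu> i))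
        = trunk_weight lam k * (if i \<in> J \<eta> then ennreal ((cmod (lam (Branch i 1)))\<^sup>2) *
          (\<integral>\<^sup>+s. 1 / ennreal (s ^ (l + 1)) \<partial>\<mu> i) else 0)"
      proof (cases "i \<in> J \<eta>")
        case True
        let ?c = "trunk_weight lam k * ennreal ((cmod (lam (Branch i 1)))\<^sup>2)"
        have "(\<integral>\<^sup>+s. 1 / ennreal (s ^ l) * h i s \<partial>extend_to_line (\<mu> i))
          = (\<integral>\<^sup>+s. ?c * (1 / ennreal (s ^ (l + 1))) \<partial>extend_to_line (\<mu> i))"
        proof (rule nn_integral_cong_AE)
          show "AE s in extend_to_line (\<mu> i). 1 / ennreal (s ^ l) * h i s = ?c * (1 / ennreal (s ^ (l + 1)))"
            using AE_extend_to_line[OF prob[OF True]]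
          proof eventually_elim
            case (elim s)
            have "1 / ennreal (s ^ l) * (1 / ennreal s) = 1 / ennreal (s ^ (l + 1))"
            proof (cases "s = 0")
              case True
              then show ?thesis by (cases l) (auto simp: ennreal_divide_top ennreal_top_mult)
            next
              case False
              then have "0 < s" using elim by simp
              then show ?thesis
                using divide_ennreal[of 1 "s ^ l"] divide_ennreal[of 1 s] divide_ennreal[of 1 "s ^ (l + 1)"]
                by (simp flip: ennreal_mult)
            qed
            moreover have "1 / ennreal (s ^ l) * h i s = ?c * (1 / ennreal (s ^ l) * (1 / ennreal s))"
              using True by (simp add: h_def mult_ac)
            ultimately show ?case by simp
          qed
        qed
        also have "\<dots> = ?c * (\<integral>\<^sup>+s. 1 / ennreal (s ^ (l + 1)) \<partial>extend_to_line (\<mu> i))"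
          by (rule nn_integral_cmult) measurable
        finally show ?thesis
          using True by (simp add: nn_integral_extend_to_line[OF prob] mult.assoc)
      qed (simp add: h_def)
    qed
    also have "\<dots> = trunk_weight lam k * branch_sum \<eta> lam \<mu> l"
      unfolding branch_sum_def infsum_ennreal_eq_nn_integral by (rule nn_integral_cmult) simp
    finally show ?thesis .
  qed
  show "trunk_weight lam l * branch_sum \<eta> lam \<mu> l = 1" if l: "l < k"
  proof -
    let ?R = "ennreal ((cmod (\<Prod>j=l..<k. lam (Trunk j)))\<^sup>2)"
    have "(\<integral>\<^sup>+s. 1 / ennreal (s ^ l) * ennreal (s ^ k) \<partial>extend_to_line \<nu>) = (\<integral>\<^sup>+s. ennreal (s ^ (k - l)) \<partial>extend_to_line \<nu>)"
    proof (rule nn_integral_cong_AE)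
      show "AE s in extend_to_line \<nu>. 1 / ennreal (s ^ l) * ennreal (s ^ k) = ennreal (s ^ (k - l))"
        using AE_extend_to_line[OF \<nu>]
      proof eventually_elim
        case (elim s)
        show ?case
        proof (cases "s = 0")
          case True
          then show ?thesis using l by (simp add: power_0_left)
        next
          case False
          then have "0 < s" using elim by simp
          then show ?thesis
            using divide_ennreal[of 1 "s ^ l"] l by (simp add: power_diff flip: ennreal_mult)
        qed
      qed
    qed
    also have "\<dots> = (\<integral>\<^sup>+s. ennreal (s ^ (k - l)) \<partial>\<nu>)"
      by (rule nn_integral_extend_to_line[OF \<nu>]) measurable
    also have "\<dots> = ?R" using mom[of "k - l"] l by simp
    finally have "?R = trunk_weight lam k * branch_sum \<eta> lam \<mu> l" by (simp add: moment)
    also have "trunk_weight lam k = ?R * trunk_weight lam l"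
    proof -
      have "(\<Prod>j<k. lam (Trunk j)) = (\<Prod>j=l..<k. lam (Trunk j)) * (\<Prod>j<l. lam (Trunk j))"
        using prod.atLeastLessThan_concat[of 0 l k "\<lambda>j. lam (Trunk j)"] l
        by (simp add: lessThan_atLeast0 mult.commute)
      then show ?thesis by (simp only: norm_mult power_mult_distrib ennreal_mult zero_le_power2)
    qed
    finally have "?R * (trunk_weight lam l * branch_sum \<eta> lam \<mu> l) = ?R * 1" by (simp add: mult.assoc)
    moreover have "?R \<noteq> 0" using nz by auto
    ultimately show ?thesis by (subst (asm) ennreal_mult_cancel_left) auto
  qed
  have "trunk_weight lam k * branch_sum \<eta> lam \<mu> k = (\<integral>\<^sup>+s. 1 / ennreal (s ^ k) * ennreal (s ^ k) \<partial>extend_to_line \<nu>)"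
    by (simp only: moment)
  also have "\<dots> \<le> (\<integral>\<^sup>+s. 1 \<partial>extend_to_line \<nu>)"
  proof (rule nn_integral_mono)
    fix s
    show "1 / ennreal (s ^ k) * ennreal (s ^ k) \<le> 1"
    proof (cases "0 < s ^ k")
      case True
      then show ?thesis using divide_ennreal[of 1 "s ^ k"] by (simp flip: ennreal_mult)
    next
      case False
      then show ?thesis by (simp add: ennreal_neg)
    qed
  qed
  also have "\<dots> = 1"
    using emeasure_extend_to_line[OF \<nu>] sets_eq_imp_space_eq[OF sets_extend_to_line, of \<nu>] by simp
  finally show "trunk_weight lam k * branch_sum \<eta> lam \<mu> k \<le> 1" .
qed

end

theorem theorem6p2p1:
  fixes \<eta> \<kappa> :: enat
    and lam :: "vertex \<Rightarrow> complex"
    and \<mu> :: "nat \<Rightarrow> real measure"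
  assumes eta: "2 \<le> \<eta>"
    and nonzero: "\<And>v. v \<in> nonroot (tree_V \<eta> \<kappa>) (tree_E \<eta> \<kappa>) \<Longrightarrow> lam v \<noteq> 0"
    and e0: "indicator {Trunk 0} \<in> C_infinity_domain (ell2 (tree_V \<eta> \<kappa>)) (tree_shift \<eta> \<kappa> lam)"
    and prob: "\<And>i. i \<in> J \<eta> \<Longrightarrow> borel_prob_halfline (\<mu> i)"
    and moments: "\<And>n i. 1 \<le> n \<Longrightarrow> i \<in> J \<eta> \<Longrightarrow>
      (\<integral>\<^sup>+s. ennreal (s ^ n) \<partial>\<mu> i) = ennreal ((cmod (\<Prod>j=2..n+1. lam (Branch i j)))\<^sup>2)"
    and cases:
      "(\<comment> \<open>(i)\<close> \<kappa> = 0 \<and>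
          (\<Sum>\<^sub>\<infinity>i\<in>J \<eta>. ennreal ((cmod (lam (Branch i 1)))\<^sup>2) * (\<integral>\<^sup>+s. 1 / ennreal s \<partial>\<mu> i)) \<le> 1) \<or>
       (\<comment> \<open>(ii)\<close> \<exists>k::nat. \<kappa> = enat k \<and> 0 < k \<and>
          (\<Sum>\<^sub>\<infinity>i\<in>J \<eta>. ennreal ((cmod (lam (Branch i 1)))\<^sup>2) * (\<integral>\<^sup>+s. 1 / ennreal s \<partial>\<mu> i)) = 1 \<and>
          (\<forall>l\<in>J (enat (k - 1)).
             ennreal ((cmod (\<Prod>j<l. lam (Trunk j)))\<^sup>2) *
             (\<Sum>\<^sub>\<infinity>i\<in>J \<eta>. ennreal ((cmod (lam (Branch i 1)))\<^sup>2) *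
                (\<integral>\<^sup>+s. 1 / ennreal (s ^ (l + 1)) \<partial>\<mu> i)) = 1) \<and>
          ennreal ((cmod (\<Prod>j<k. lam (Trunk j)))\<^sup>2) *
          (\<Sum>\<^sub>\<infinity>i\<in>J \<eta>. ennreal ((cmod (lam (Branch i 1)))\<^sup>2) *
             (\<integral>\<^sup>+s. 1 / ennreal (s ^ (k + 1)) \<partial>\<mu> i)) \<le> 1) \<or>
       (\<comment> \<open>(iii)\<close> \<exists>k::nat. \<kappa> = enat k \<and> 0 < k \<and>
          (\<exists>\<nu>. borel_prob_halfline \<nu> \<and>
             (\<forall>n\<in>J \<kappa>. (\<integral>\<^sup>+s. ennreal (s ^ n) \<partial>\<nu>) =
                ennreal ((cmod (\<Prod>j=k-n..<k. lam (Trunk j)))\<^sup>2)) \<and>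
             (\<forall>\<sigma>\<in>sets (restrict_space borel {0..}).
                (\<integral>\<^sup>+s\<in>\<sigma>. ennreal (s ^ k) \<partial>\<nu>) =
                ennreal ((cmod (\<Prod>j<k. lam (Trunk j)))\<^sup>2) *
                (\<Sum>\<^sub>\<infinity>i\<in>J \<eta>. ennreal ((cmod (lam (Branch i 1)))\<^sup>2) *
                   (\<integral>\<^sup>+s\<in>\<sigma>. 1 / ennreal s \<partial>\<mu> i))))) \<or>
       (\<comment> \<open>(iv)\<close> \<kappa> = \<infinity> \<and>
          (\<Sum>\<^sub>\<infinity>i\<in>J \<eta>. ennreal ((cmod (lam (Branch i 1)))\<^sup>2) * (\<integral>\<^sup>+s. 1 / ennreal s \<partial>\<mu> i)) = 1 \<and>
          (\<forall>l\<ge>1.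
             ennreal ((cmod (\<Prod>j<l. lam (Trunk j)))\<^sup>2) *
             (\<Sum>\<^sub>\<infinity>i\<in>J \<eta>. ennreal ((cmod (lam (Branch i 1)))\<^sup>2) *
                (\<integral>\<^sup>+s. 1 / ennreal (s ^ (l + 1)) \<partial>\<mu> i)) = 1))"
  shows "subnormal (ell2 (tree_V \<eta> \<kappa>)) (tree_shift \<eta> \<kappa> lam)"
proof -
  let ?m = "\<lambda>i. extend_to_line (\<mu> i)"
  let ?w = "trunk_weight lam"
  have trunk: "trunk_moment \<eta> lam ?m k = ?w k * branch_sum \<eta> lam \<mu> k" for k
    by (rule trunk_moment_eq[OF prob])
  have sum0: "(\<Sum>\<^sub>\<infinity>i\<in>J \<eta>. ennreal ((cmod (lam (Branch i 1)))\<^sup>2) * (\<integral>\<^sup>+s. 1 / ennreal s \<partial>\<mu> i))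
    = trunk_moment \<eta> lam ?m 0"
    by (simp add: trunk branch_sum_def)
  have "(\<forall>k. enat k < \<kappa> \<longrightarrow> trunk_moment \<eta> lam ?m k = 1) \<and>
    (\<forall>k. enat k = \<kappa> \<longrightarrow> trunk_moment \<eta> lam ?m k \<le> 1)"
    using cases unfolding sum0 branch_sum_def[symmetric] trunk[symmetric]
  proof (elim disjE exE conjE)
    assume "\<kappa> = 0" "trunk_moment \<eta> lam ?m 0 \<le> 1"
    then show ?thesis by (auto simp: zero_enat_def)
  next
    fix k assume k: "\<kappa> = enat k" "0 < k" "trunk_moment \<eta> lam ?m 0 = 1"
      "\<forall>l\<in>J (enat (k - 1)). trunk_moment \<eta> lam ?m l = 1" "trunk_moment \<eta> lam ?m k \<le> 1"
    have "trunk_moment \<eta> lam ?m l = 1" if "l < k" for l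
      using k that by (cases "l = 0") (auto simp: J_def)
    then show ?thesis using k by auto
  next
    fix k \<nu>
    assume k: "\<kappa> = enat k" "0 < k" and \<nu>: "borel_prob_halfline \<nu>"
      and mom: "\<forall>n\<in>J \<kappa>. (\<integral>\<^sup>+s. ennreal (s ^ n) \<partial>\<nu>) = ennreal ((cmod (\<Prod>j=k-n..<k. lam (Trunk j)))\<^sup>2)"
      and eq: "\<forall>\<sigma>\<in>sets (restrict_space borel {0..}). (\<integral>\<^sup>+s\<in>\<sigma>. ennreal (s ^ k) \<partial>\<nu>) = ?w k *
        (\<Sum>\<^sub>\<infinity>i\<in>J \<eta>. ennreal ((cmod (lam (Branch i 1)))\<^sup>2) * (\<integral>\<^sup>+s\<in>\<sigma>. 1 / ennreal s \<partial>\<mu> i))"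
    have nz: "lam (Trunk j) \<noteq> 0" if "j < k" for j
      using nonzero that k by (simp add: Trunk_nonroot)
    note * = trunk_moments_of_measure[of \<eta> \<mu> \<nu> k lam, OF prob \<nu> k(2) nz _ bspec[OF eq]]
    show ?thesis
      unfolding trunk using k mom *(1) *(2) by (auto simp: J_def)
  next
    assume "\<kappa> = \<infinity>" "trunk_moment \<eta> lam ?m 0 = 1" "\<forall>l\<ge>1. trunk_moment \<eta> lam ?m l = 1"
    then show ?thesis by (metis enat.distinct(1) less_one linorder_not_less)
  qed
  then have eq_1: "\<And>k. enat k < \<kappa> \<Longrightarrow> trunk_moment \<eta> lam ?m k = 1"
    and le_1: "\<And>k. enat k = \<kappa> \<Longrightarrow> trunk_moment \<eta> lam ?m k \<le> 1" by blast+
  have "trunk_moment \<eta> lam ?m 0 \<le> 1"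
    using eq_1[of 0] le_1[of 0] by (cases "\<kappa> = 0") (auto simp: zero_enat_def[symmetric])
  interpret tree_moments \<eta> \<kappa> lam ?m
  proof
    fix i assume i: "i \<in> J \<eta>"
    show "emeasure (?m i) UNIV = 1" by (rule emeasure_extend_to_line[OF prob[OF i]])
    show "AE s in ?m i. 0 < s"
      by (rule AE_pos_if_trunk_moment_finite[OF prob \<open>trunk_moment \<eta> lam ?m 0 \<le> 1\<close> i])
        (use i nonzero in \<open>auto simp: Branch_nonroot\<close>)
    show "(\<integral>\<^sup>+s. ennreal (s ^ n) \<partial>?m i) = ennreal ((cmod (\<Prod>j=2..n+1. lam (Branch i j)))\<^sup>2)"
      if "1 \<le> n" for n
      using moments[OF that i] nn_integral_extend_to_line[OF prob[OF i], of "\<lambda>s. ennreal (s ^ n)"] by simp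
  qed (use nonzero eq_1 le_1 in auto)
  show ?thesis by (rule subnormal_tree_shift[OF e0])
qed

end
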